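(* Let $I\subseteq[m]\times[r]$, $J\subseteq[n]\times[r]$ be such that the representative rank-one supports are pairwise disjoint ($\mathcal{S}_P\cap\mathcal{S}_{P'}=\emptyset$ for distinct equivalence classes $P,P'$). Then for every $A\in\mathbb{R}^{m\times n}$ the function $L(X,Y)=\|A-XY^\top\|^2$ on the feasible set has no spurious local valley. In addition, $L$ has the strict saddle property: every critical point of $L$ is either a global minimizer or a point at which the Hessian of $L$ has a strictly negative eigenvalue (so $L$ has no spurious local minimum).
   Context: $[p]=\{1,\dots,p\}$; $\|\cdot\|$ Frobenius norm; $\mathrm{supp}(M)=\{(i,j):M_{i,j}\ne0\}$. The feasible set is $\{(X,Y)\in\mathbb{R}^{m\times r}\times\mathbb{R}^{n\times r}:\mathrm{supp}(X)\subseteq I,\mathrm{supp}(Y)\subseteq J\}$, identified with $\mathbb{R}^{|I|+|J|}$, and $L$ is regarded as a function on it. Rank-one supports: $\mathcal{S}_k=\{i:(i,k)\in I\}\times\{j:(j,k)\in J\}$; equivalence $k\sim l$ iff $\mathcal{S}_k=\mathcal{S}_l$; for an equivalence class $P$, $\mathcal{S}_P$ is the common support. Sublevel set $E_\alpha=\{x:L(x)\le\alpha\}$; a local valley is a nonempty path-connected component of a sublevel set; it is spurious if it contains no global minimizer. A spurious local minimum is a local minimizer that is not a global minimizer. *)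

theory Defs
  imports "HOL-Analysis.Analysis"
begin

section \<open>Factorization with fixed supports\<close>

definition supp :: "real^'b^'a \<Rightarrow> ('a \<times> 'b) set" where
  "supp M = {(i, j). M $ i $ j \<noteq> 0}"

definition feasible :: "('m::finite \<times> 'r::finite) set \<Rightarrow> ('n::finite \<times> 'r) set \<Rightarrow> ((real^'r^'m) \<times> (real^'r^'n)) set" where
  "feasible I J = {(X, Y). supp X \<subseteq> I \<and> supp Y \<subseteq> J}"

text \<open>The library norm on \<open>real^'n^'m\<close> is the Frobenius norm.\<close>

definition loss :: "real^'n::finite^'m::finite \<Rightarrow> (real^'r^'m) \<times> (real^'r^'n) \<Rightarrow> real" where
  "loss A = (\<lambda>(X, Y). (norm (A - X ** transpose Y))\<^sup>2)"

definition rank_one_support :: "('m \<times> 'r) set \<Rightarrow> ('n \<times> 'r) set \<Rightarrow> 'r \<Rightarrow> ('m \<times> 'n) set" where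
  "rank_one_support I J k = {i. (i, k) \<in> I} \<times> {j. (j, k) \<in> J}"

definition support_rel :: "('m \<times> 'r) set \<Rightarrow> ('n \<times> 'r) set \<Rightarrow> ('r \<times> 'r) set" where
  "support_rel I J = {(k, l). rank_one_support I J k = rank_one_support I J l}"

definition support_classes :: "('m \<times> 'r) set \<Rightarrow> ('n \<times> 'r) set \<Rightarrow> 'r set set" where
  "support_classes I J = UNIV // support_rel I J"

text \<open>On an equivalence class \<open>P\<close> the image below is a singleton.\<close>

definition class_support :: "('m \<times> 'r) set \<Rightarrow> ('n \<times> 'r) set \<Rightarrow> 'r set \<Rightarrow> ('m \<times> 'n) set" where
  "class_support I J P = the_elem (rank_one_support I J ` P)"


section \<open>Landscape of a function on a set\<close>

definition global_minimizer :: "'a set \<Rightarrow> ('a \<Rightarrow> real) \<Rightarrow> 'a \<Rightarrow> bool" where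
  "global_minimizer S f x \<longleftrightarrow> is_arg_min f (\<lambda>y. y \<in> S) x"

definition local_minimizer :: "'a::topological_space set \<Rightarrow> ('a \<Rightarrow> real) \<Rightarrow> 'a \<Rightarrow> bool" where
  "local_minimizer S f x \<longleftrightarrow> x \<in> S \<and> (\<forall>\<^sub>F y in at x within S. f x \<le> f y)"

definition spurious_local_minimum :: "'a::topological_space set \<Rightarrow> ('a \<Rightarrow> real) \<Rightarrow> 'a \<Rightarrow> bool" where
  "spurious_local_minimum S f x \<longleftrightarrow> local_minimizer S f x \<and> \<not> global_minimizer S f x"

definition sublevel :: "'a set \<Rightarrow> ('a \<Rightarrow> real) \<Rightarrow> real \<Rightarrow> 'a set" where
  "sublevel S f \<alpha> = {x \<in> S. f x \<le> \<alpha>}"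

definition local_valley :: "'a::topological_space set \<Rightarrow> ('a \<Rightarrow> real) \<Rightarrow> 'a set \<Rightarrow> bool" where
  "local_valley S f V \<longleftrightarrow>
     (\<exists>\<alpha>. \<exists>x \<in> sublevel S f \<alpha>. V = path_component_set (sublevel S f \<alpha>) x)"

definition spurious_local_valley :: "'a::topological_space set \<Rightarrow> ('a \<Rightarrow> real) \<Rightarrow> 'a set \<Rightarrow> bool" where
  "spurious_local_valley S f V \<longleftrightarrow> local_valley S f V \<and> (\<forall>x \<in> V. \<not> global_minimizer S f x)"


section \<open>First and second order conditions on a coordinate subspace\<close>

text \<open>
  Below, \<open>S\<close> is a coordinate subspace, that is, \<open>S = span (S \<inter> Basis)\<close>, and the members of
  \<open>S \<inter> Basis\<close> are its coordinate directions. For \<open>S = feasible I J\<close> these are the pairs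
  \<open>(E\<^sub>i\<^sub>k, 0)\<close> with \<open>(i, k) \<in> I\<close> and \<open>(0, E\<^sub>j\<^sub>k)\<close> with \<open>(j, k) \<in> J\<close>, which realises the
  identification of the feasible set with a Euclidean space of dimension \<open>card I + card J\<close>.
  Only variations inside \<open>S\<close> enter the derivatives.
\<close>

definition critical_point :: "'a::euclidean_space set \<Rightarrow> ('a \<Rightarrow> real) \<Rightarrow> 'a \<Rightarrow> bool" where
  "critical_point S f x \<longleftrightarrow> x \<in> S \<and> (f has_derivative (\<lambda>_. 0)) (at x within S)"

definition partial_deriv :: "'a::euclidean_space \<Rightarrow> ('a \<Rightarrow> real) \<Rightarrow> 'a \<Rightarrow> real" where
  "partial_deriv b f x = deriv (\<lambda>t. f (x + t *\<^sub>R b)) 0"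

text \<open>The linear map whose matrix in the coordinates of \<open>S\<close> consists of the second partial
  derivatives of \<open>f\<close> at \<open>x\<close>.\<close>

definition hessian :: "'a::euclidean_space set \<Rightarrow> ('a \<Rightarrow> real) \<Rightarrow> 'a \<Rightarrow> 'a \<Rightarrow> 'a" where
  "hessian S f x v =
     (\<Sum>b \<in> S \<inter> Basis. (\<Sum>c \<in> S \<inter> Basis. partial_deriv b (partial_deriv c f) x * (v \<bullet> c)) *\<^sub>R b)"

definition hessian_eigenvalue :: "'a::euclidean_space set \<Rightarrow> ('a \<Rightarrow> real) \<Rightarrow> 'a \<Rightarrow> real \<Rightarrow> bool" where
  "hessian_eigenvalue S f x \<mu> \<longleftrightarrow> (\<exists>v \<in> S. v \<noteq> 0 \<and> hessian S f x v = \<mu> *\<^sub>R v)"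

end

theory Submission
  imports Defs
begin

text \<open>
  The loss is a sum of independent losses, one for each rank-one support, up to a constant, so
  the second-order analysis can be done for one block \<open>F + \<Sum>a\<^sub>k b\<^sub>k\<^sup>T\<close> with residual \<open>F\<close>. Let \<open>\<sigma>\<close> be the
  top singular value of \<open>F\<close>, with singular vectors \<open>u\<close>, \<open>v\<close>. Testing the Hessian on the directions
  \<open>(\<alpha>\<^sub>k u, \<beta>\<^sub>k v)\<close> shows that if it is positive semidefinite, then the \<open>a\<^sub>k\<close> are linearly independent
  and the nonzero singular values of \<open>\<Sum>a\<^sub>k b\<^sub>k\<^sup>T\<close> are at least \<open>\<sigma>\<close>; a comparison of two orthogonal projections
  in the spirit of Eckart and Young then gives global optimality.

  Hence the loss strictly decreases along some straight segment starting at any point that is not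
  a global minimizer. For valleys it remains to see that the loss attains its infimum on a path
  component of a sublevel set: a Gram-Schmidt process on the columns, which keeps the product \<open>X Y\<^sup>T\<close>
  fixed along a path, moves each point to a bounded region, and compactness applies.
\<close>

section \<open>Matrices and rank-one terms\<close>

definition outer :: "real^'m \<Rightarrow> real^'n \<Rightarrow> real^'n^'m" where
  "outer u v = (\<chi> i j. u $ i * v $ j)"

lemma outer_nth [simp]: "outer u v $ i $ j = u $ i * v $ j"
  by (simp add: outer_def)

lemma outer_zero [simp]: "outer 0 v = 0" "outer u 0 = 0"
  by (simp_all add: vec_eq_iff)

lemma outer_mult_vector: "outer u v *v w = (v \<bullet> w) *\<^sub>R u"
  by (simp add: vec_eq_iff matrix_vector_mult_def inner_vec_def sum_distrib_left mult_ac)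

lemma vector_mult_outer: "w v* outer u v = (u \<bullet> w) *\<^sub>R v"
  by (simp add: vec_eq_iff vector_matrix_mult_def inner_vec_def sum_distrib_right sum_distrib_left mult_ac)

lemma inner_matrix_outer: "M \<bullet> outer u v = u \<bullet> (M *v v)"
  by (simp add: inner_vec_def matrix_vector_mult_def sum_distrib_left mult_ac)

lemma inner_outer_outer: "outer a b \<bullet> outer c d = (a \<bullet> c) * (b \<bullet> d)"
  by (simp add: inner_matrix_outer outer_mult_vector inner_commute)

lemma transpose_outer: "transpose (outer u v) = outer v u"
  by (simp add: transpose_def vec_eq_iff mult_ac)

lemma outer_sum_left: "outer (\<Sum>k\<in>K. f k) v = (\<Sum>k\<in>K. outer (f k) v)"
  by (simp add: vec_eq_iff sum_distrib_right)

lemma outer_sum_right: "outer u (\<Sum>k\<in>K. f k) = (\<Sum>k\<in>K. outer u (f k))"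
  by (simp add: vec_eq_iff sum_distrib_left)

lemma outer_scaleR: "outer (c *\<^sub>R u) v = c *\<^sub>R outer u v" "outer u (c *\<^sub>R v) = c *\<^sub>R outer u v"
  by (simp_all add: vec_eq_iff)

lemma sum_matrix_vector: "(\<Sum>k\<in>K. M k) *v x = (\<Sum>k\<in>K. M k *v x)"
  by (induction K rule: infinite_finite_induct) (auto simp: matrix_vector_mult_add_rdistrib)

lemma vector_matrix_sum: "x v* (\<Sum>k\<in>K. M k) = (\<Sum>k\<in>K. x v* M k)" for M :: "_ \<Rightarrow> real^'n^'m"
  by (induction K rule: infinite_finite_induct) (auto simp: algebra_simps)

lemma transpose_sum: "transpose (\<Sum>k\<in>K. M k) = (\<Sum>k\<in>K. transpose (M k))" for M :: "_ \<Rightarrow> real^'n^'m"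
  by (simp add: vec_eq_iff transpose_def)

section \<open>Adjoints and row norms for the Frobenius inner product\<close>

lemma inner_matrix_mult_right: "(M ** N) \<bullet> L = M \<bullet> (L ** transpose N)" for M :: "real^'k^'m"
  unfolding inner_vec_def matrix_matrix_mult_def transpose_def
  by (simp add: sum_distrib_right sum_distrib_left mult_ac) (rule sum.cong[OF refl], rule sum.swap)

lemma inner_transpose_transpose: "transpose M \<bullet> transpose N = M \<bullet> (N :: real^'k^'m)"
  unfolding inner_vec_def transpose_def by simp (rule sum.swap)

lemma inner_matrix_mult_left: "(M ** N) \<bullet> L = N \<bullet> (transpose M ** L)" for M :: "real^'k^'m"
  using inner_matrix_mult_right[of "transpose N" "transpose M" "transpose L"]
  by (simp add: inner_transpose_transpose flip: matrix_transpose_mul)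
    (metis inner_transpose_transpose matrix_transpose_mul transpose_transpose)

lemma matrix_mult_nth: "(R ** M) $ i = (R $ i) v* M" for R :: "real^'k^'m"
  by (simp add: vec_eq_iff matrix_matrix_mult_def vector_matrix_mult_def mult_ac)

lemma norm_matrix_square: "(norm M)\<^sup>2 = (\<Sum>i\<in>UNIV. (norm (M $ i))\<^sup>2)" for M :: "real^'k^'m"
  by (simp add: power2_norm_eq_inner inner_vec_def)

text \<open>Both squared norms split over rows, and row \<open>i\<close> of \<open>R ** S\<close> is
  \<open>R $ i v* S\<close>, so the pointwise bound can be used row by row.\<close>

lemma norm_matrix_mult_mono:
  fixes R :: "real^'k^'m" and S :: "real^'n^'k" and T :: "real^'l^'k"
  assumes "\<And>x. norm (x v* S) \<le> c * norm (x v* T)"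
  shows "(norm (R ** S))\<^sup>2 \<le> c\<^sup>2 * (norm (R ** T))\<^sup>2"
proof -
  have "(norm (R ** S))\<^sup>2 \<le> (\<Sum>i\<in>UNIV. (c * norm (R $ i v* T))\<^sup>2)"
    unfolding norm_matrix_square matrix_mult_nth
    by (intro sum_mono power_mono assms) auto
  then show ?thesis
    by (simp add: norm_matrix_square matrix_mult_nth sum_distrib_left power_mult_distrib)
qed

section \<open>Orthogonal projections and top singular vectors\<close>

text \<open>\<open>Q\<close> is the sum of \<open>outer b b\<close> over an orthonormal basis. Its
  squared Frobenius norm is its trace, so a dimension becomes an inner product of matrices.\<close>

lemma orthogonal_projection_matrix:
  fixes W :: "(real^'m) set"
  assumes "subspace W"
  obtains Q where "transpose Q = Q" "Q ** Q = Q" "Q \<bullet> Q = dim W"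
    "\<And>x. x \<in> W \<Longrightarrow> Q *v x = x" "\<And>x. Q *v x \<in> W"
proof -
  obtain B where B: "B \<subseteq> W" "pairwise orthogonal B" "\<And>x. x \<in> B \<Longrightarrow> norm x = 1"
      "independent B" "card B = dim W" "span B = W"
    using orthonormal_basis_subspace[OF assms] by metis
  have fin: "finite B"
    using B(4) by (rule independent_imp_finite)
  have ip: "b \<bullet> c = (if b = c then 1 else 0)" if "b \<in> B" "c \<in> B" for b c
    using that B(2,3) by (auto simp: pairwise_def orthogonal_def norm_eq_1)
  define Q where "Q = (\<Sum>b\<in>B. outer b b)"
  have Qv: "Q *v x = (\<Sum>b\<in>B. (b \<bullet> x) *\<^sub>R b)" for x
    by (simp add: Q_def sum_matrix_vector outer_mult_vector)
  have QW: "Q *v x \<in> W" for x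
    unfolding Qv using assms B(1) by (intro subspace_sum subspace_scale) auto
  have idW: "Q *v x = x" if "x \<in> W" for x
  proof -
    have "x \<in> span B" using that B(6) by simp
    moreover have "Q *v b = id b" if "b \<in> B" for b
      using that fin by (simp add: Qv ip if_distrib[of "\<lambda>c. c *\<^sub>R _"] sum.delta' cong: if_cong)
    ultimately have "Q *v x = id x"
      by (rule linear_eq_on_span[OF matrix_vector_mul_linear linear_id, rotated])
    then show ?thesis by simp
  qed
  show ?thesis
  proof (rule that[of Q])
    show "transpose Q = Q"
      by (simp add: Q_def transpose_sum transpose_outer)
    show "Q ** Q = Q"
      by (simp add: matrix_eq flip: matrix_vector_mul_assoc) (simp add: idW QW)
    have "Q \<bullet> Q = (\<Sum>b\<in>B. b \<bullet> (Q *v b))"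
      unfolding Q_def[symmetric] by (subst (2) Q_def) (simp add: inner_sum_right inner_matrix_outer)
    also have "\<dots> = (\<Sum>b\<in>B. 1)"
      using idW B(1) ip by (intro sum.cong) auto
    finally show "Q \<bullet> Q = dim W" using B(5) by simp
  qed (use QW idW in auto)
qed

text \<open>\<open>u\<close> maximizes \<open>norm (x v* F)\<close> on the unit sphere and \<sigma>
  is the maximum. That \<open>F\<close> maps \<open>v\<close> back to a multiple of \<open>u\<close>
  is the equality case of Cauchy-Schwarz.\<close>

lemma top_singular_pair:
  fixes F :: "real^'n^'m"
  assumes "F \<noteq> 0"
  obtains \<sigma> u v where "\<sigma> > 0" "norm u = 1" "norm v = 1" "F *v v = \<sigma> *\<^sub>R u" "u v* F = \<sigma> *\<^sub>R v"
    "\<And>x. norm (x v* F) \<le> \<sigma> * norm x"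
proof -
  have "continuous_on (sphere 0 1) (\<lambda>x. norm (x v* F))"
    unfolding transpose_matrix_vector[symmetric] by (intro continuous_intros linear_continuous_on matrix_vector_mul_bounded_linear)
  moreover have "sphere (0::real^'m) 1 \<noteq> {}"
    by (auto intro!: exI[of _ "axis undefined 1"] simp: norm_axis_1)
  ultimately obtain u where u: "u \<in> sphere 0 1" "\<And>x. x \<in> sphere 0 1 \<Longrightarrow> norm (x v* F) \<le> norm (u v* F)"
    using continuous_attains_sup[OF compact_sphere] by blast
  define \<sigma> where "\<sigma> = norm (u v* F)"
  have bound: "norm (x v* F) \<le> \<sigma> * norm x" for x
  proof (cases "x = 0")
    case False
    then have "norm (((1 / norm x) *\<^sub>R x) v* F) \<le> \<sigma>"
      unfolding \<sigma>_def by (intro u(2)) auto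
    also have "((1 / norm x) *\<^sub>R x) v* F = (1 / norm x) *\<^sub>R (x v* F)"
      unfolding transpose_matrix_vector[symmetric] by (rule matrix_vector_mult_scaleR)
    finally show ?thesis using False by (simp add: field_simps)
  qed auto
  have "\<sigma> \<noteq> 0"
  proof
    assume "\<sigma> = 0"
    then have "x v* F = 0" for x using bound[of x] by simp
    then have "transpose F = 0"
      unfolding matrix_eq transpose_matrix_vector by simp
    then show False using assms by (simp add: transpose_def vec_eq_iff)
  qed
  then have pos: "\<sigma> > 0" by (simp add: \<sigma>_def)
  define v where "v = (1 / \<sigma>) *\<^sub>R (u v* F)"
  have nv: "norm v = 1" using pos by (simp add: v_def \<sigma>_def)
  have uF: "u v* F = \<sigma> *\<^sub>R v" using pos by (simp add: v_def)
  \<comment> \<open>The bound for the transpose passes to \<open>F\<close> at \<open>v\<close>,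
    since \<sigma> also bounds the action on the row vector \<open>F *v v\<close>.\<close>
  have "(norm (F *v v))\<^sup>2 = ((F *v v) v* F) \<bullet> v"
    by (simp add: power2_norm_eq_inner dot_lmul_matrix)
  also have "\<dots> \<le> norm ((F *v v) v* F) * norm v" by (rule norm_cauchy_schwarz)
  also have "\<dots> \<le> \<sigma> * norm (F *v v)" using bound nv by simp
  finally have Fv: "norm (F *v v) \<le> \<sigma>"
    using pos by (cases "norm (F *v v) = 0") (auto simp: power2_eq_square)
  have "u \<bullet> (F *v v) = \<sigma>"
    using nv by (simp add: uF norm_eq_1 flip: dot_lmul_matrix)
  moreover have "u \<bullet> u = 1" using u(1) by (simp add: norm_eq_1)
  moreover have "(norm (F *v v))\<^sup>2 \<le> \<sigma>\<^sup>2" using Fv by (intro power_mono) auto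
  ultimately have "(norm (F *v v - \<sigma> *\<^sub>R u))\<^sup>2 \<le> 0"
    unfolding power2_norm_eq_inner
    by (simp add: inner_diff_left inner_diff_right inner_commute power2_eq_square)
  then have "F *v v = \<sigma> *\<^sub>R u" by simp
  then show ?thesis using that pos u(1) nv uF bound by auto
qed

lemma bounded_bilinear_matrix_matrix_mult:
  "bounded_bilinear (\<lambda>(M :: real^'k^'m) (N :: real^'n^'k). M ** N)"
  unfolding bilinear_conv_bounded_bilinear[symmetric] bilinear_def
  by (auto intro!: linearI simp: vec_eq_iff matrix_matrix_mult_def sum.distrib sum_distrib_left
      algebra_simps)

lemmas matrix_mult_diff_distribs =
  bounded_bilinear.diff_left[OF bounded_bilinear_matrix_matrix_mult]
  bounded_bilinear.diff_right[OF bounded_bilinear_matrix_matrix_mult]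

lemmas matrix_mult_add_distribs =
  bounded_bilinear.add_left[OF bounded_bilinear_matrix_matrix_mult]
  bounded_bilinear.add_right[OF bounded_bilinear_matrix_matrix_mult]

text \<open>By symmetry \<open>P \<bullet> Q\<close> is the trace of \<open>P ** Q\<close>, and
  idempotence reduces every mixed term of the expansion to it. The same trace appears when
  \<open>P\<close> and \<open>Q\<close> are exchanged, which makes the two losses
  comparable.\<close>

lemma norm_projection_complement:
  fixes P Q :: "real^'m^'m"
  assumes "transpose P = P" "P ** P = P" "transpose Q = Q" "Q ** Q = Q"
  shows "(norm (P ** (mat 1 - Q)))\<^sup>2 = P \<bullet> P - P \<bullet> Q"
proof -
  have 1: "P \<bullet> (P ** Q) = P \<bullet> Q"
    using inner_matrix_mult_left[of P Q P] assms by (simp add: inner_commute)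
  have "(P ** Q) \<bullet> (P ** Q) = P \<bullet> (P ** Q)"
    using inner_matrix_mult_right[of P Q "P ** Q"] assms by (simp flip: matrix_mul_assoc)
  then have 2: "(P ** Q) \<bullet> (P ** Q) = P \<bullet> Q"
    using 1 by simp
  moreover have "(P ** Q) \<bullet> P = P \<bullet> Q"
    using 1 by (simp add: inner_commute)
  ultimately show ?thesis using 1
    by (simp add: matrix_mult_diff_distribs power2_norm_eq_inner inner_diff_left inner_diff_right)
qed

text \<open>
  With \<open>P\<close>, \<open>Q\<close> the projections onto \<open>U\<close>, \<open>W\<close>: removing the columns of \<open>Z\<close> by \<open>1 - P\<close> loses at most
  \<open>\<sigma>\<^sup>2 (dim U - tr P Q)\<close> from \<open>F\<close> and keeps at least \<open>\<sigma>\<^sup>2 (dim W - tr P Q)\<close> of \<open>M\<close>.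
\<close>

lemma norm_le_norm_add_of_gap:
  fixes F M Z :: "real^'n^'m" and U W :: "(real^'m) set"
  assumes sub: "subspace U" "subspace W" and dim: "dim U \<le> dim W"
    and F_W: "\<And>x. x \<in> W \<Longrightarrow> x v* F = 0" and F_le: "\<And>x. norm (x v* F) \<le> \<sigma> * norm x"
    and M_ge: "\<And>x. x \<in> W \<Longrightarrow> \<sigma> * norm x \<le> norm (x v* M)"
    and M_col: "\<And>x. (\<And>y. y \<in> W \<Longrightarrow> x \<bullet> y = 0) \<Longrightarrow> x v* M = 0"
    and Z_col: "\<And>x. (\<And>y. y \<in> U \<Longrightarrow> x \<bullet> y = 0) \<Longrightarrow> x v* Z = 0"
    and MF: "M ** transpose F = 0" and \<sigma>: "\<sigma> > 0"
  shows "(norm F)\<^sup>2 \<le> (norm (F + M - Z))\<^sup>2"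
proof -
  obtain P where P: "transpose P = P" "P ** P = P" "P \<bullet> P = dim U"
      "\<And>x. x \<in> U \<Longrightarrow> P *v x = x" "\<And>x. P *v x \<in> U"
    using orthogonal_projection_matrix[OF sub(1)] by metis
  obtain Q where Q: "transpose Q = Q" "Q ** Q = Q" "Q \<bullet> Q = dim W"
      "\<And>x. x \<in> W \<Longrightarrow> Q *v x = x" "\<And>x. Q *v x \<in> W"
    using orthogonal_projection_matrix[OF sub(2)] by metis
  define R where "R = mat 1 - P"
  have R: "transpose R = R" "R ** R = R"
    using P(1) by (simp_all add: R_def matrix_mult_diff_distribs P(2))
      (simp add: transpose_def vec_eq_iff mat_def eq_commute)
  have Pv: "x v* P = P *v x" and Qv: "x v* Q = Q *v x" for x
    using P(1) Q(1) by (metis transpose_matrix_vector)+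
  have orth: "(x - P *v x) \<bullet> y = 0" if "y \<in> U" for x y
    using that P(4)[OF that] dot_lmul_matrix[of x P y] by (simp add: Pv inner_diff_left)
  have orthQ: "(x - Q *v x) \<bullet> y = 0" if "y \<in> W" for x y
    using that Q(4)[OF that] dot_lmul_matrix[of x Q y] by (simp add: Qv inner_diff_left)
  have "R ** Z = 0"
  proof -
    \<comment> \<open>The rows of \<open>R\<close> are orthogonal to \<open>U\<close>, where all
      columns of \<open>Z\<close> lie.\<close>
    have "R $ i v* Z = 0" for i
    proof (rule Z_col)
      fix y assume "y \<in> U"
      then have "R *v y = 0"
        using P(4) by (simp add: R_def matrix_vector_mult_diff_rdistrib)
      then show "R $ i \<bullet> y = 0"
        by (metis matrix_vector_mul_component zero_index)
    qed
    then show ?thesis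
      by (simp add: vec_eq_iff[of "R ** Z"] matrix_mult_nth)
  qed
  then have RN: "R ** (F + M - Z) = R ** F + R ** M"
    by (simp add: matrix_mult_diff_distribs matrix_mult_add_distribs)
  have R_le: "(norm (R ** N))\<^sup>2 = N \<bullet> (R ** N)" for N :: "real^'n^'m"
    unfolding power2_norm_eq_inner using inner_matrix_mult_left[of R N "R ** N"]
    by (simp add: R matrix_mul_assoc)
  have RN_le: "(norm (R ** N))\<^sup>2 \<le> (norm N)\<^sup>2" for N :: "real^'n^'m"
  proof -
    have "norm (R ** N) * norm (R ** N) \<le> norm N * norm (R ** N)"
      using R_le[of N] norm_cauchy_schwarz[of N "R ** N"] by (simp add: power2_eq_square)
    then have "norm (R ** N) \<le> norm N"
      by (cases "norm (R ** N) = 0") auto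
    then show ?thesis by (intro power_mono) auto
  qed
  have "(R ** F) \<bullet> (R ** M) = F \<bullet> (R ** M)"
    using inner_matrix_mult_left[of R F "R ** M"] by (simp add: R matrix_mul_assoc)
  also have "\<dots> = R \<bullet> (F ** transpose M)"
    by (simp add: inner_commute[of F] inner_matrix_mult_right)
  also have "F ** transpose M = transpose (M ** transpose F)"
    by (simp add: matrix_transpose_mul)
  also have "\<dots> = 0"
    unfolding MF by (simp add: transpose_def vec_eq_iff)
  finally have cross: "(R ** F) \<bullet> (R ** M) = 0"
    by simp
  \<comment> \<open>\<open>F\<close> vanishes on \<open>W\<close>, so it acts on row vectors through
    \<open>mat 1 - Q\<close> with gain at most \<sigma>.\<close>
  have PF: "(norm (P ** F))\<^sup>2 \<le> \<sigma>\<^sup>2 * (dim U - P \<bullet> Q)"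
  proof -
    have "norm (x v* F) \<le> \<sigma> * norm (x v* (mat 1 - Q))" for x
    proof -
      have "x v* F = (x - Q *v x) v* F"
        using F_W[OF Q(5)[of x]] by (simp add: vector_matrix_mult_diff_distrib)
      then show ?thesis
        using F_le[of "x - Q *v x"] by (simp add: vector_matrix_mult_diff_rdistrib Qv)
    qed
    from norm_matrix_mult_mono[OF this, of P] show ?thesis
      using norm_projection_complement[OF P(1,2) Q(1,2)] P(3) by simp
  qed
  \<comment> \<open>\<open>M\<close> acts through \<open>Q\<close>, and on \<open>W\<close> its gain
    is at least \<sigma>.\<close>
  have RM: "(norm (R ** M))\<^sup>2 \<ge> \<sigma>\<^sup>2 * (dim W - P \<bullet> Q)"
  proof -
    have "norm (x v* Q) \<le> 1 / \<sigma> * norm (x v* M)" for x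
    proof -
      have "x v* M = (Q *v x) v* M"
        using M_col[of "x - Q *v x"] orthQ by (simp add: vector_matrix_mult_diff_distrib)
      then show ?thesis
        using M_ge[OF Q(5)[of x]] \<sigma> by (simp add: Qv field_simps)
    qed
    from norm_matrix_mult_mono[OF this, of R]
    have "(norm (R ** Q))\<^sup>2 \<le> (1 / \<sigma>)\<^sup>2 * (norm (R ** M))\<^sup>2" .
    moreover have "norm (R ** Q) = norm (Q ** (mat 1 - P))"
      using inner_transpose_transpose[of "R ** Q" "R ** Q"] R(1) Q(1)
      by (simp add: norm_eq_sqrt_inner matrix_transpose_mul R_def)
    ultimately show ?thesis
      using norm_projection_complement[OF Q(1,2) P(1,2)] Q(3) \<sigma>
      by (simp add: field_simps inner_commute)
  qed
  have "(norm F)\<^sup>2 - (norm (P ** F))\<^sup>2 = (norm (R ** F))\<^sup>2"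
  proof -
    have "(norm (P ** F))\<^sup>2 = F \<bullet> (P ** F)"
      unfolding power2_norm_eq_inner using inner_matrix_mult_left[of P F "P ** F"]
      by (simp add: P(1,2) matrix_mul_assoc)
    then show ?thesis
      unfolding R_le by (simp add: R_def matrix_mult_diff_distribs inner_diff_right power2_norm_eq_inner)
  qed
  moreover have "\<sigma>\<^sup>2 * (dim U - P \<bullet> Q) \<le> \<sigma>\<^sup>2 * (dim W - P \<bullet> Q)"
    using dim by (intro mult_left_mono) auto
  ultimately have "(norm F)\<^sup>2 \<le> (norm (R ** F))\<^sup>2 + (norm (R ** M))\<^sup>2"
    using PF RM by linarith
  also have "\<dots> = (norm (R ** (F + M - Z)))\<^sup>2"
    unfolding RN using cross by (simp add: power2_norm_eq_inner inner_add_left inner_add_right inner_commute)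
  also have "\<dots> \<le> (norm (F + M - Z))\<^sup>2" by (rule RN_le)
  finally show ?thesis .
qed

section \<open>A single full block\<close>

text \<open>Independence concerns sets while \<open>a\<close> is a family. A repeated vector would
  give a kernel element with coefficients 1 and -1, so \<open>a\<close> is injective on
  \<open>K\<close>.\<close>

lemma card_le_dim_of_trivial_kernel:
  fixes a :: "'r \<Rightarrow> 'a::euclidean_space"
  assumes fin: "finite K"
    and ker: "\<And>\<beta> k. (\<Sum>k\<in>K. \<beta> k *\<^sub>R a k) = 0 \<Longrightarrow> k \<in> K \<Longrightarrow> \<beta> k = 0"
  shows "card K \<le> dim (span (a ` K))"
proof -
  have inj: "inj_on a K"
  proof (rule inj_onI, rule ccontr)
    fix k l assume kl: "k \<in> K" "l \<in> K" "a k = a l" "k \<noteq> l"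
    let ?\<beta> = "\<lambda>j. (if j = k then 1 else 0) - (if j = l then 1 else (0::real))"
    have "(\<Sum>j\<in>K. ?\<beta> j *\<^sub>R a j) = 0"
      using kl fin by (simp add: scaleR_left_diff_distrib sum_subtractf if_distrib[of "\<lambda>c. c *\<^sub>R _"] cong: if_cong)
    from ker[OF this kl(1)] show False using kl(4) by simp
  qed
  have "independent (a ` K)"
  proof (rule independent_if_scalars_zero)
    fix f x assume f: "(\<Sum>x\<in>a ` K. f x *\<^sub>R x) = 0" and "x \<in> a ` K"
    then obtain k where k: "k \<in> K" "x = a k" by auto
    have "(\<Sum>k\<in>K. f (a k) *\<^sub>R a k) = 0"
      using f by (simp add: sum.reindex[OF inj])
    from ker[OF this k(1)] show "f x = 0" by (simp add: k(2))
  qed (use fin in auto)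
  then have "dim (span (a ` K)) = card (a ` K)"
    by (simp add: dim_eq_card_independent)
  then show ?thesis using card_image[OF inj] by simp
qed

lemma span_image_sum:
  assumes "finite K" "x \<in> span (a ` K)"
  shows "\<exists>\<beta>. x = (\<Sum>k\<in>K. \<beta> k *\<^sub>R a k)"
  using assms(2)
proof (induction rule: span_induct_alt)
  case base
  then show ?case by (intro exI[of _ "\<lambda>_. 0"]) simp
next
  case (step r y z)
  then obtain k \<beta> where "k \<in> K" "y = a k" "z = (\<Sum>k\<in>K. \<beta> k *\<^sub>R a k)" by auto
  then have "r *\<^sub>R y + z = (\<Sum>j\<in>K. ((if j = k then r else 0) + \<beta> j) *\<^sub>R a j)"
    using assms(1)
    by (simp add: scaleR_left_distrib sum.distrib if_distrib[of "\<lambda>c. c *\<^sub>R _"] cong: if_cong)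
  then show ?case by (intro exI[of _ "\<lambda>j. (if j = k then r else 0) + \<beta> j"])
qed

text \<open>\<open>F\<close> is the residual of a critical point, and \<open>second\<close> is
  semidefiniteness of the Hessian on directions with columns \<open>\<alpha> k *\<^sub>R u\<close>
  and \<open>\<beta> k *\<^sub>R v\<close>. Inserting the top singular pair gives an inequality in
  \<alpha> and \<beta> alone, whose special cases supply the hypotheses of
  \<open>norm_le_norm_add_of_gap\<close>.\<close>

lemma full_block_optimality:
  fixes F :: "real^'n^'m" and a c :: "'r \<Rightarrow> real^'m" and b d :: "'r \<Rightarrow> real^'n"
  assumes fin: "finite K"
    and Fb: "\<And>k. k \<in> K \<Longrightarrow> F *v b k = 0" and aF: "\<And>k. k \<in> K \<Longrightarrow> a k v* F = 0"
    and second: "\<And>u v \<alpha> \<beta>. u \<in> range (\<lambda>x. F *v x) \<Longrightarrow> v \<in> range (\<lambda>x. x v* F) \<Longrightarrow>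
      2 * (\<Sum>k\<in>K. \<alpha> k * \<beta> k) * (u \<bullet> (F *v v)) \<le>
        (norm (outer u (\<Sum>k\<in>K. \<alpha> k *\<^sub>R b k) + outer (\<Sum>k\<in>K. \<beta> k *\<^sub>R a k) v))\<^sup>2"
  shows "(norm F)\<^sup>2 \<le> (norm (F + (\<Sum>k\<in>K. outer (a k) (b k)) - (\<Sum>k\<in>K. outer (c k) (d k))))\<^sup>2"
proof (cases "F = 0")
  case False
  obtain \<sigma> u v where \<sigma>: "\<sigma> > 0" and u: "norm u = 1" and v: "norm v = 1"
      and Fv: "F *v v = \<sigma> *\<^sub>R u" and uF: "u v* F = \<sigma> *\<^sub>R v"
      and bound: "\<And>x. norm (x v* F) \<le> \<sigma> * norm x"
    using top_singular_pair[OF False] by metis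
  have u_range: "u \<in> range (\<lambda>x. F *v x)"
  proof
    show "u = F *v ((1 / \<sigma>) *\<^sub>R v)"
      using Fv \<sigma> by (simp add: matrix_vector_mult_scaleR)
  qed simp
  have v_range: "v \<in> range (\<lambda>x. x v* F)"
  proof
    show "v = ((1 / \<sigma>) *\<^sub>R u) v* F"
      using matrix_vector_mult_scaleR[of "transpose F" "1 / \<sigma>" u] uF \<sigma> by simp
  qed simp
  \<comment> \<open>\<open>u\<close> lies in the column space of \<open>F\<close>, to which every
    \<open>a k\<close> is orthogonal; this removes the mixed term from the square in
    \<open>second\<close>.\<close>
  have ua: "u \<bullet> a k = 0" if "k \<in> K" for k
  proof -
    have "\<sigma> * (u \<bullet> a k) = 0"
      using Fv aF[OF that] dot_lmul_matrix[of "a k" F v] by (simp add: inner_commute)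
    then show ?thesis using \<sigma> by simp
  qed
  have second': "2 * \<sigma> * (\<Sum>k\<in>K. \<alpha> k * \<beta> k) \<le>
      (norm (\<Sum>k\<in>K. \<alpha> k *\<^sub>R b k))\<^sup>2 + (norm (\<Sum>k\<in>K. \<beta> k *\<^sub>R a k))\<^sup>2" for \<alpha> \<beta> :: "'r \<Rightarrow> real"
  proof -
    have "u \<bullet> (\<Sum>k\<in>K. \<beta> k *\<^sub>R a k) = 0"
      by (simp add: inner_sum_right ua)
    then show ?thesis
      using second[OF u_range v_range, of \<alpha> \<beta>] u v Fv
      by (simp add: power2_norm_eq_inner inner_add_left inner_add_right inner_outer_outer norm_eq_1
          inner_commute mult_ac)
  qed
  let ?W = "span (a ` K)" and ?U = "span (c ` K)"
  define M where "M = (\<Sum>k\<in>K. outer (a k) (b k))"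
  have xM: "x v* M = (\<Sum>k\<in>K. (a k \<bullet> x) *\<^sub>R b k)" for x
    by (simp add: M_def vector_matrix_sum vector_mult_outer)
  \<comment> \<open>With \<beta> in the kernel, taking \<alpha> as \<open>s\<close> times \<beta>
    leaves a linear term in \<open>s\<close> bounded by a quadratic one, which fails for small
    positive \<open>s\<close> unless \<beta> vanishes on \<open>K\<close>.\<close>
  have ker: "\<beta> k = 0" if \<beta>: "(\<Sum>k\<in>K. \<beta> k *\<^sub>R a k) = 0" and k: "k \<in> K" for \<beta> k
  proof -
    define B where "B = (norm (\<Sum>k\<in>K. \<beta> k *\<^sub>R b k))\<^sup>2"
    define N where "N = (\<Sum>k\<in>K. (\<beta> k)\<^sup>2)"
    have le: "2 * \<sigma> * (s * N) \<le> s\<^sup>2 * B" for s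
    proof -
      have "(\<Sum>k\<in>K. (s * \<beta> k) *\<^sub>R b k) = s *\<^sub>R (\<Sum>k\<in>K. \<beta> k *\<^sub>R b k)"
        by (simp add: scaleR_sum_right)
      then show ?thesis
        using second'[of "\<lambda>k. s * \<beta> k" \<beta>] \<beta>
        by (simp add: B_def N_def power_mult_distrib power2_eq_square sum_distrib_left mult_ac)
    qed
    have "N \<ge> 0" "B \<ge> 0" by (auto simp: N_def B_def intro: sum_nonneg)
    have "N = 0"
    proof (rule ccontr)
      assume "N \<noteq> 0"
      with \<open>N \<ge> 0\<close> have N: "N > 0" by simp
      \<comment> \<open>Small enough that \<open>s * B\<close> is at most
        \<open>\<sigma> * N\<close>; the added 1 covers \<open>B = 0\<close>.\<close>
      define s where "s = \<sigma> * N / (B + 1)"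
      have s: "s > 0" using N \<sigma> \<open>B \<ge> 0\<close> by (simp add: s_def)
      have "s * (2 * \<sigma> * N) \<le> s * (s * B)" using le[of s] by (simp add: power2_eq_square mult_ac)
      then have "2 * \<sigma> * N \<le> s * B" using s by simp
      also have "\<dots> \<le> s * (B + 1)" using s by simp
      also have "\<dots> = \<sigma> * N" using \<open>B \<ge> 0\<close> by (simp add: s_def)
      finally show False using N \<sigma> by simp
    qed
    then show ?thesis using k fin by (simp add: N_def sum_nonneg_eq_0_iff)
  qed
  have "(norm F)\<^sup>2 \<le> (norm (F + M - (\<Sum>k\<in>K. outer (c k) (d k))))\<^sup>2"
  proof (rule norm_le_norm_add_of_gap[of ?U ?W])
    have "dim ?U \<le> card (c ` K)" using fin by (intro dim_le_card) auto
    also have "\<dots> \<le> card K" using fin by (rule card_image_le)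
    also have "\<dots> \<le> dim ?W" using fin ker by (rule card_le_dim_of_trivial_kernel)
    finally show "dim ?U \<le> dim ?W" .
    show "x v* F = 0" if "x \<in> ?W" for x
      using that
    proof (induction rule: span_induct_alt)
      case (step r x y)
      then show ?case
        using aF matrix_vector_mult_scaleR[of "transpose F" r x] by (auto simp: vector_matrix_left_distrib)
    qed simp
    show "norm (x v* F) \<le> \<sigma> * norm x" for x by (rule bound)
    show "\<sigma> * norm x \<le> norm (x v* M)" if "x \<in> ?W" for x
    proof -
      obtain \<beta> where \<beta>: "x = (\<Sum>k\<in>K. \<beta> k *\<^sub>R a k)"
        using span_image_sum[OF fin \<open>x \<in> ?W\<close>] by blast
      \<comment> \<open>With \<beta> the coefficients of \<open>x\<close> and
        \<open>\<alpha> k = (a k \<bullet> x) / \<sigma>\<close>, the left side of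
        \<open>second'\<close> is twice the squared norm of \<open>x\<close>, and one copy cancels
        against the right side.\<close>
      have "(\<Sum>k\<in>K. (a k \<bullet> x) * \<beta> k) = x \<bullet> x"
        by (subst (3) \<beta>) (simp add: inner_sum_right inner_commute mult_ac)
      moreover have "(\<Sum>k\<in>K. (a k \<bullet> x / \<sigma>) *\<^sub>R b k) = (1 / \<sigma>) *\<^sub>R (x v* M)"
        by (simp add: xM scaleR_sum_right)
      ultimately have "2 * (x \<bullet> x) \<le> (norm (x v* M) / \<sigma>)\<^sup>2 + x \<bullet> x"
        using second'[of "\<lambda>k. (a k \<bullet> x) / \<sigma>" \<beta>] \<sigma>
        by (simp add: power2_norm_eq_inner[of x] flip: \<beta> sum_divide_distrib)
      then have "(norm x)\<^sup>2 \<le> (norm (x v* M) / \<sigma>)\<^sup>2"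
        by (simp add: power2_norm_eq_inner[of x])
      then have "norm x \<le> norm (x v* M) / \<sigma>"
        using \<sigma> by (simp add: power2_le_iff_abs_le)
      then show ?thesis using \<sigma> by (simp add: field_simps)
    qed
    show "x v* M = 0" if "\<And>y. y \<in> ?W \<Longrightarrow> x \<bullet> y = 0" for x
      unfolding xM using that[OF span_base] by (auto simp: inner_commute[of _ x] intro!: sum.neutral)
    show "x v* (\<Sum>k\<in>K. outer (c k) (d k)) = 0" if "\<And>y. y \<in> ?U \<Longrightarrow> x \<bullet> y = 0" for x
      unfolding vector_matrix_sum vector_mult_outer
      using that[OF span_base] by (auto simp: inner_commute[of _ x] intro!: sum.neutral)
    have "(M ** transpose F) *v x = 0" for x
    proof -
      have "b k \<bullet> (x v* F) = 0" if "k \<in> K" for k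
        using Fb[OF that] by (simp add: inner_commute[of "b k"] dot_lmul_matrix)
      then show ?thesis
        by (simp add: M_def sum_matrix_vector outer_mult_vector flip: matrix_vector_mul_assoc)
    qed
    then show "M ** transpose F = 0" by (simp add: matrix_eq)
  qed (use \<sigma> in auto)
  then show ?thesis by (simp add: M_def)
qed simp

section \<open>The factorized product on the feasible set\<close>

definition fprod :: "(real^'r^'m) \<times> (real^'r^'n) \<Rightarrow> real^'n^'m" where
  "fprod x = fst x ** transpose (snd x)"

text \<open>The derivative of \<open>fprod\<close> at \<open>x\<close> in direction
  \<open>v\<close>. It is also the polarization of the quadratic map \<open>fprod\<close>, hence
  symmetric and bilinear.\<close>

definition fprod_deriv :: "(real^'r^'m) \<times> (real^'r^'n) \<Rightarrow> (real^'r^'m) \<times> (real^'r^'n) \<Rightarrow> real^'n^'m" where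
  "fprod_deriv x v = fst v ** transpose (snd x) + fst x ** transpose (snd v)"

lemma loss_eq: "loss A x = (norm (A - fprod x))\<^sup>2"
  by (cases x) (simp add: loss_def fprod_def)

lemma matrix_mult_transpose_columns:
  "M ** transpose N = (\<Sum>k\<in>UNIV. outer (column k M) (column k N))" for M :: "real^'r^'m" and N :: "real^'r^'n"
  by (simp add: vec_eq_iff matrix_matrix_mult_def transpose_def column_def)

lemma fprod_deriv_commute: "fprod_deriv x v = fprod_deriv v x"
  by (simp add: fprod_deriv_def add.commute)

lemma fprod_add_scaleR: "fprod (x + t *\<^sub>R v) = fprod x + t *\<^sub>R fprod_deriv x v + t\<^sup>2 *\<^sub>R fprod v"
  by (simp add: fprod_def fprod_deriv_def vec_eq_iff matrix_matrix_mult_def transpose_def sum.distrib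
      sum_distrib_left algebra_simps power2_eq_square)

lemma bounded_bilinear_fprod_deriv: "bounded_bilinear fprod_deriv"
  unfolding bilinear_conv_bounded_bilinear[symmetric] bilinear_def
  by (auto intro!: linearI simp: fprod_deriv_def vec_eq_iff matrix_matrix_mult_def transpose_def
      sum.distrib sum_distrib_left algebra_simps)

lemma feasible_iff:
  "x \<in> feasible I J \<longleftrightarrow> (\<forall>i k. (i, k) \<notin> I \<longrightarrow> fst x $ i $ k = 0) \<and> (\<forall>j k. (j, k) \<notin> J \<longrightarrow> snd x $ j $ k = 0)"
  by (cases x) (auto simp: feasible_def supp_def)

lemma subspace_feasible: "subspace (feasible I J)"
  by (auto simp: subspace_def feasible_iff)

section \<open>Column directions and restriction to blocks\<close>

text \<open>Used for test directions that move only the columns belonging to one block.\<close>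

definition cols :: "'r set \<Rightarrow> ('r \<Rightarrow> real^'m) \<Rightarrow> real^'r^'m" where
  "cols K f = (\<chi> i k. if k \<in> K then f k $ i else 0)"

lemma column_cols: "column k (cols K f) = (if k \<in> K then f k else 0)"
  by (simp add: column_def cols_def vec_eq_iff)

lemma cols_mult_transpose:
  "cols K f ** transpose N = (\<Sum>k\<in>K. outer (f k) (column k N))"
  "M ** transpose (cols K g) = (\<Sum>k\<in>K. outer (column k M) (g k))" for K :: "'r::finite set"
  unfolding matrix_mult_transpose_columns column_cols
  by (rule sum.mono_neutral_cong_right; auto)+

definition mask_entries :: "('m \<times> 'n) set \<Rightarrow> real^'n^'m \<Rightarrow> real^'n^'m" where
  "mask_entries D M = (\<chi> i j. if (i, j) \<in> D then M $ i $ j else 0)"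

lemma norm_matrix_square_entries: "(norm M)\<^sup>2 = (\<Sum>(i, j)\<in>UNIV. (M $ i $ j)\<^sup>2)" for M :: "real^'n^'m"
  unfolding power2_norm_eq_inner inner_vec_def
  by (simp add: sum.cartesian_product power2_eq_square)

lemma norm_mask_square: "(norm (mask_entries D M))\<^sup>2 = (\<Sum>(i, j)\<in>D. (M $ i $ j)\<^sup>2)"
  unfolding norm_matrix_square_entries
  by (rule sum.mono_neutral_cong_right) (auto simp: mask_entries_def)

text \<open>Disjointness splits a squared norm into the masked parts and a remainder, and on the
  remainder the two matrices agree.\<close>

lemma norm_square_le_of_mask_le:
  fixes M N :: "real^'n^'m"
  assumes dis: "disjoint \<D>"
    and le: "\<And>D. D \<in> \<D> \<Longrightarrow> (norm (mask_entries D M))\<^sup>2 \<le> (norm (mask_entries D N))\<^sup>2"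
    and out: "\<And>i j. (i, j) \<notin> \<Union>\<D> \<Longrightarrow> M $ i $ j = N $ i $ j"
  shows "(norm M)\<^sup>2 \<le> (norm N)\<^sup>2"
proof -
  have split: "(norm L)\<^sup>2 = (\<Sum>D\<in>\<D>. (norm (mask_entries D L))\<^sup>2) + (\<Sum>(i, j)\<in>-\<Union>\<D>. (L $ i $ j)\<^sup>2)"
    for L :: "real^'n^'m"
  proof -
    have "(norm L)\<^sup>2 = (\<Sum>(i, j)\<in>\<Union>\<D>. (L $ i $ j)\<^sup>2) + (\<Sum>(i, j)\<in>-\<Union>\<D>. (L $ i $ j)\<^sup>2)"
      unfolding norm_matrix_square_entries by (subst sum.union_disjoint[symmetric]) (auto intro: sum.cong)
    also have "(\<Sum>(i, j)\<in>\<Union>\<D>. (L $ i $ j)\<^sup>2) = (\<Sum>D\<in>\<D>. (norm (mask_entries D L))\<^sup>2)"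
      unfolding norm_mask_square using dis
      by (subst sum.Union_disjoint) (auto simp: disjoint_def)
    finally show ?thesis .
  qed
  have "(\<Sum>(i, j)\<in>-\<Union>\<D>. (M $ i $ j)\<^sup>2) = (\<Sum>(i, j)\<in>-\<Union>\<D>. (N $ i $ j)\<^sup>2)"
    using out by (intro sum.cong) auto
  then show ?thesis
    unfolding split[of M] split[of N] using sum_mono[OF le] by simp
qed

lemma fprod_nth: "fprod x $ i $ j = (\<Sum>k\<in>UNIV. fst x $ i $ k * snd x $ j $ k)"
  by (simp add: fprod_def matrix_matrix_mult_def transpose_def)

text \<open>On \<open>D\<close> the product involves only the columns with rank-one support
  \<open>D\<close>, because all other supports are disjoint from it. What remains is an
  unconstrained factorization over a full rectangle, to which \<open>full_block_optimality\<close>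
  applies with the masked residual.\<close>

lemma second_order_optimal_on_block:
  fixes I :: "('m::finite \<times> 'r::finite) set" and J :: "('n::finite \<times> 'r) set" and A :: "real^'n^'m"
  assumes dis: "disjoint (range (rank_one_support I J))"
    and x: "x \<in> feasible I J" and z: "z \<in> feasible I J"
    and first: "\<And>v. v \<in> feasible I J \<Longrightarrow> (A - fprod x) \<bullet> fprod_deriv x v = 0"
    and second: "\<And>v. v \<in> feasible I J \<Longrightarrow> 2 * ((A - fprod x) \<bullet> fprod v) \<le> (norm (fprod_deriv x v))\<^sup>2"
    and D: "D \<in> range (rank_one_support I J)"
  shows "(norm (mask_entries D (A - fprod x)))\<^sup>2 \<le> (norm (mask_entries D (A - fprod z)))\<^sup>2"
proof (cases "D = {}")
  case True
  then show ?thesis by (simp add: norm_mask_square)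
next
  case False
  define E where "E = A - fprod x"
  define F where "F = mask_entries D E"
  obtain k0 where k0: "D = rank_one_support I J k0" using D by auto
  define R where "R = {i. (i, k0) \<in> I}"
  define C where "C = {j. (j, k0) \<in> J}"
  have DRC: "D = R \<times> C" by (simp add: k0 rank_one_support_def R_def C_def)
  define K where "K = {k. rank_one_support I J k = D}"
  \<comment> \<open>A nonempty product set determines its factors, which is why the empty
    \<open>D\<close> is treated separately.\<close>
  have KRC: "(i, k) \<in> I \<longleftrightarrow> i \<in> R" "(j, k) \<in> J \<longleftrightarrow> j \<in> C" if "k \<in> K" for k i j
    using that False unfolding K_def DRC rank_one_support_def by (auto simp: times_eq_iff)
  have outside: "(i, j) \<notin> D" if "k \<notin> K" "(i, k) \<in> I" "(j, k) \<in> J" for i j k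
  proof -
    have "rank_one_support I J k \<inter> D = {}"
      using that(1) dis D unfolding disjoint_def K_def by blast
    moreover have "(i, j) \<in> rank_one_support I J k" using that by (simp add: rank_one_support_def)
    ultimately show ?thesis by blast
  qed
  have feas: "(cols K f, cols K g) \<in> feasible I J"
    if "\<And>k i. k \<in> K \<Longrightarrow> i \<notin> R \<Longrightarrow> f k $ i = 0" "\<And>k j. k \<in> K \<Longrightarrow> j \<notin> C \<Longrightarrow> g k $ j = 0" for f g
    using that KRC by (auto simp: feasible_iff cols_def)
  define a where "a k = column k (fst x)" for k
  define b where "b k = column k (snd x)" for k
  have a_supp: "a k $ i = 0" if "k \<in> K" "i \<notin> R" for k i
    using x KRC that by (auto simp: feasible_iff a_def column_def)
  have b_supp: "b k $ j = 0" if "k \<in> K" "j \<notin> C" for k j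
    using x KRC that by (auto simp: feasible_iff b_def column_def)
  \<comment> \<open>Vectors supported in \<open>R\<close> and \<open>C\<close> cannot distinguish
    the residual from its mask.\<close>
  have EF: "u \<bullet> (E *v w) = u \<bullet> (F *v w)" if "\<And>i. i \<notin> R \<Longrightarrow> u $ i = 0" "\<And>j. j \<notin> C \<Longrightarrow> w $ j = 0" for u w
  proof -
    have "u $ i * (E $ i $ j * w $ j) = u $ i * (F $ i $ j * w $ j)" for i j
      using that(1)[of i] that(2)[of j] by (cases "i \<in> R"; cases "j \<in> C") (auto simp: F_def mask_entries_def DRC)
    note entry = this
    show ?thesis
      unfolding inner_vec_def matrix_vector_mult_def
      by (simp only: inner_real_def vec_lambda_beta sum_distrib_left entry)
  qed
  have F_range: "(F *v w) $ i = 0" if "i \<notin> R" for w i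
    using that by (simp add: F_def mask_entries_def DRC matrix_vector_mult_def)
  have F_range': "(w v* F) $ j = 0" if "j \<notin> C" for w j
    using that by (simp add: F_def mask_entries_def DRC vector_matrix_mult_def)
  have fprod_deriv_cols: "fprod_deriv x (cols K f, cols K g) =
      (\<Sum>k\<in>K. outer (f k) (b k)) + (\<Sum>k\<in>K. outer (a k) (g k))" for f g
    by (simp add: fprod_deriv_def cols_mult_transpose a_def b_def)
  have Fb: "F *v b k = 0" if "k \<in> K" for k
  proof -
    \<comment> \<open>Moving column \<open>k\<close> of the first factor along
      \<open>F *v b k\<close> turns stationarity into the vanishing of the squared norm of
      \<open>F *v b k\<close>.\<close>
    let ?f = "\<lambda>l. if l = k then F *v b k else 0"
    have "0 = E \<bullet> fprod_deriv x (cols K ?f, cols K (\<lambda>_. 0))"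
      unfolding E_def by (intro first[symmetric] feas) (auto simp: F_range)
    also have "\<dots> = (\<Sum>l\<in>K. E \<bullet> outer (?f l) (b l))"
      by (simp add: fprod_deriv_cols inner_sum_right)
    also have "\<dots> = (\<Sum>l\<in>K. if l = k then E \<bullet> outer (F *v b k) (b k) else 0)"
      by (intro sum.cong) auto
    also have "\<dots> = (F *v b k) \<bullet> (E *v b k)"
      using that by (simp add: inner_matrix_outer)
    also have "\<dots> = (F *v b k) \<bullet> (F *v b k)"
      using that by (intro EF) (auto simp: F_range b_supp)
    finally show ?thesis by simp
  qed
  have aF: "a k v* F = 0" if "k \<in> K" for k
  proof -
    let ?g = "\<lambda>l. if l = k then a k v* F else 0"
    have "0 = E \<bullet> fprod_deriv x (cols K (\<lambda>_. 0), cols K ?g)"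
      unfolding E_def by (intro first[symmetric] feas) (auto simp: F_range')
    also have "\<dots> = (\<Sum>l\<in>K. E \<bullet> outer (a l) (?g l))"
      by (simp add: fprod_deriv_cols inner_sum_right)
    also have "\<dots> = (\<Sum>l\<in>K. if l = k then E \<bullet> outer (a k) (a k v* F) else 0)"
      by (intro sum.cong) auto
    also have "\<dots> = a k \<bullet> (E *v (a k v* F))"
      using that by (simp add: inner_matrix_outer)
    also have "\<dots> = a k \<bullet> (F *v (a k v* F))"
      using that by (intro EF) (auto simp: F_range' a_supp)
    also have "\<dots> = (a k v* F) \<bullet> (a k v* F)"
      by (simp add: dot_lmul_matrix)
    finally show ?thesis by simp
  qed
  have opt: "(norm F)\<^sup>2 \<le> (norm (F + (\<Sum>k\<in>K. outer (a k) (b k)) -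
      (\<Sum>k\<in>K. outer (column k (fst z)) (column k (snd z)))))\<^sup>2"
  proof (rule full_block_optimality)
    fix u v and \<alpha> \<beta> :: "'r \<Rightarrow> real"
    assume "u \<in> range (\<lambda>x. F *v x)" "v \<in> range (\<lambda>x. x v* F)"
    \<comment> \<open>Vectors in the ranges of \<open>F\<close> have the right supports, so the test
      direction is feasible.\<close>
    then have u: "\<And>i. i \<notin> R \<Longrightarrow> u $ i = 0" and v: "\<And>j. j \<notin> C \<Longrightarrow> v $ j = 0"
      using F_range F_range' by auto
    let ?v = "(cols K (\<lambda>k. \<alpha> k *\<^sub>R u), cols K (\<lambda>k. \<beta> k *\<^sub>R v))"
    have "2 * (E \<bullet> fprod ?v) \<le> (norm (fprod_deriv x ?v))\<^sup>2"
      unfolding E_def by (intro second feas) (auto simp: u v)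
    moreover have "fprod ?v = (\<Sum>k\<in>K. (\<alpha> k * \<beta> k) *\<^sub>R outer u v)"
      by (auto simp: fprod_def cols_mult_transpose column_cols outer_scaleR intro!: sum.cong)
    then have "E \<bullet> fprod ?v = (\<Sum>k\<in>K. \<alpha> k * \<beta> k) * (u \<bullet> (F *v v))"
      by (simp add: inner_matrix_outer EF[OF u v] flip: scaleR_sum_left)
    moreover have "fprod_deriv x ?v = outer u (\<Sum>k\<in>K. \<alpha> k *\<^sub>R b k) + outer (\<Sum>k\<in>K. \<beta> k *\<^sub>R a k) v"
      by (simp add: fprod_deriv_cols outer_sum_left outer_sum_right outer_scaleR)
    ultimately show "2 * (\<Sum>k\<in>K. \<alpha> k * \<beta> k) * (u \<bullet> (F *v v)) \<le>
        (norm (outer u (\<Sum>k\<in>K. \<alpha> k *\<^sub>R b k) + outer (\<Sum>k\<in>K. \<beta> k *\<^sub>R a k) v))\<^sup>2"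
      by simp
  qed (use Fb aF in auto)
  have mask_fprod: "mask_entries D (fprod y) = (\<Sum>k\<in>K. outer (column k (fst y)) (column k (snd y)))"
    if y: "y \<in> feasible I J" for y
  proof -
    have "mask_entries D (fprod y) $ i $ j = (\<Sum>k\<in>K. fst y $ i $ k * snd y $ j $ k)" for i j
    proof (cases "(i, j) \<in> D")
      case True
      then have "fst y $ i $ k * snd y $ j $ k = 0" if "k \<notin> K" for k
        using outside[OF that] y unfolding feasible_iff by (metis mult_eq_0_iff)
      then have "(\<Sum>k\<in>UNIV. fst y $ i $ k * snd y $ j $ k) = (\<Sum>k\<in>K. fst y $ i $ k * snd y $ j $ k)"
        by (intro sum.mono_neutral_right) auto
      then show ?thesis using True by (simp add: mask_entries_def fprod_nth)
    next
      case False
      then have "fst y $ i $ k * snd y $ j $ k = 0" if "k \<in> K" for k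
        using that y KRC[OF that] unfolding feasible_iff DRC by (auto simp: mem_Times_iff)
      then have "(\<Sum>k\<in>K. fst y $ i $ k * snd y $ j $ k) = 0" by (intro sum.neutral) auto
      then show ?thesis using False by (simp add: mask_entries_def)
    qed
    then show ?thesis by (simp add: vec_eq_iff column_def)
  qed
  have "F + mask_entries D (fprod x) - mask_entries D (fprod z) = mask_entries D (A - fprod z)"
    by (simp add: F_def E_def mask_entries_def vec_eq_iff)
  then show ?thesis
    using opt mask_fprod[OF x] mask_fprod[OF z] by (simp add: F_def E_def a_def b_def)
qed

text \<open>Every feasible product vanishes outside the rank-one supports, so that part of the loss
  is constant and blockwise optimality adds up.\<close>

lemma second_order_imp_global_minimizer:
  fixes I :: "('m::finite \<times> 'r::finite) set" and J :: "('n::finite \<times> 'r) set" and A :: "real^'n^'m"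
  assumes dis: "disjoint (range (rank_one_support I J))"
    and x: "x \<in> feasible I J"
    and first: "\<And>v. v \<in> feasible I J \<Longrightarrow> (A - fprod x) \<bullet> fprod_deriv x v = 0"
    and second: "\<And>v. v \<in> feasible I J \<Longrightarrow> 2 * ((A - fprod x) \<bullet> fprod v) \<le> (norm (fprod_deriv x v))\<^sup>2"
  shows "global_minimizer (feasible I J) (loss A) x"
proof -
  have "loss A x \<le> loss A z" if z: "z \<in> feasible I J" for z
    unfolding loss_eq
  proof (rule norm_square_le_of_mask_le[OF dis])
    fix i j assume "(i, j) \<notin> \<Union>(range (rank_one_support I J))"
    then have "(i, k) \<notin> I \<or> (j, k) \<notin> J" for k
      by (auto simp: rank_one_support_def)
    then have "fprod y $ i $ j = 0" if "y \<in> feasible I J" for y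
      using that unfolding fprod_nth feasible_iff
      by (intro sum.neutral) (metis mult_eq_0_iff)
    then show "(A - fprod x) $ i $ j = (A - fprod z) $ i $ j"
      using x z by simp
  qed (use second_order_optimal_on_block[OF dis x z first second] in auto)
  then show ?thesis
    using x by (auto simp: global_minimizer_def is_arg_min_linorder)
qed

text \<open>Evaluating \<open>class_support\<close> at the class of \<open>k\<close> returns the
  support of \<open>k\<close>, and different supports come from different classes.\<close>

lemma disjoint_rank_one_supports:
  assumes "disjoint_family_on (class_support I J) (support_classes I J)"
  shows "disjoint (range (rank_one_support I J))"
proof -
  let ?c = "\<lambda>k. support_rel I J `` {k}"
  have cls: "?c k \<in> support_classes I J" for k
    by (simp add: support_classes_def quotientI)
  have "rank_one_support I J ` ?c k = {rank_one_support I J k}" for k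
    by (auto simp: support_rel_def)
  then have val: "class_support I J (?c k) = rank_one_support I J k" for k
    by (simp add: class_support_def)
  show ?thesis
  proof (rule disjointI)
    fix D D' assume "D \<in> range (rank_one_support I J)" "D' \<in> range (rank_one_support I J)" "D \<noteq> D'"
    then obtain k l where kl: "D = class_support I J (?c k)" "D' = class_support I J (?c l)"
      using val by auto
    then have "?c k \<noteq> ?c l" using \<open>D \<noteq> D'\<close> by auto
    then show "D \<inter> D' = {}"
      using disjoint_family_onD[OF assms cls cls] unfolding kl by blast
  qed
qed

section \<open>Second-order behaviour of the loss\<close>

interpretation fprod_deriv: bounded_bilinear fprod_deriv
  by (rule bounded_bilinear_fprod_deriv)

lemma fprod_deriv_self: "fprod_deriv v v = 2 *\<^sub>R fprod v"
  by (simp add: fprod_deriv_def fprod_def scaleR_2)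

lemma norm_quadratic_square:
  fixes E D G :: "'a::real_inner"
  shows "(norm (E - t *\<^sub>R D - t\<^sup>2 *\<^sub>R G))\<^sup>2 = (norm E)\<^sup>2 - 2 * t * (E \<bullet> D)
    + t\<^sup>2 * ((norm D)\<^sup>2 - 2 * (E \<bullet> G)) + 2 * t ^ 3 * (D \<bullet> G) + t ^ 4 * (norm G)\<^sup>2"
  unfolding power2_norm_eq_inner
  by (simp add: inner_diff_left inner_diff_right inner_commute[of D E] inner_commute[of G E]
      inner_commute[of G D] algebra_simps power2_eq_square power3_eq_cube power4_eq_xxxx)

lemma feasible_scaleR: "v \<in> feasible I J \<Longrightarrow> t *\<^sub>R v \<in> feasible I J"
  by (simp add: feasible_iff)

lemma feasible_add: "v \<in> feasible I J \<Longrightarrow> w \<in> feasible I J \<Longrightarrow> v + w \<in> feasible I J"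
  by (simp add: feasible_iff)

lemma loss_add_scaleR:
  "loss A (x + t *\<^sub>R v) = loss A x - 2 * t * ((A - fprod x) \<bullet> fprod_deriv x v)
     + t\<^sup>2 * ((norm (fprod_deriv x v))\<^sup>2 - 2 * ((A - fprod x) \<bullet> fprod v))
     + 2 * t ^ 3 * (fprod_deriv x v \<bullet> fprod v) + t ^ 4 * (norm (fprod v))\<^sup>2"
proof -
  have "A - fprod (x + t *\<^sub>R v) = (A - fprod x) - t *\<^sub>R fprod_deriv x v - t\<^sup>2 *\<^sub>R fprod v"
    by (simp add: fprod_add_scaleR)
  then show ?thesis
    unfolding loss_eq by (simp only: norm_quadratic_square)
qed

lemma loss_line_has_derivative:
  "((\<lambda>t. loss A (x + t *\<^sub>R v)) has_real_derivative - 2 * ((A - fprod x) \<bullet> fprod_deriv x v)) (at 0)"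
  unfolding loss_add_scaleR by (auto intro!: derivative_eq_intros)

lemma partial_deriv_loss: "partial_deriv c (loss A) z = - 2 * ((A - fprod z) \<bullet> fprod_deriv z c)"
  unfolding partial_deriv_def by (rule DERIV_imp_deriv[OF loss_line_has_derivative])

text \<open>The second derivative of the loss as a bilinear form. On the diagonal it is twice the
  coefficient of \<open>t\<^sup>2\<close> in \<open>loss_add_scaleR\<close>.\<close>

definition hessian_form :: "real^'n^'m \<Rightarrow> (real^'r^'m) \<times> (real^'r^'n) \<Rightarrow> (real^'r^'m) \<times> (real^'r^'n) \<Rightarrow>
    (real^'r^'m) \<times> (real^'r^'n) \<Rightarrow> real" where
  "hessian_form A x v w = 2 * (fprod_deriv x v \<bullet> fprod_deriv x w) - 2 * ((A - fprod x) \<bullet> fprod_deriv v w)"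

lemma hessian_form_commute: "hessian_form A x v w = hessian_form A x w v"
  by (simp add: hessian_form_def inner_commute fprod_deriv_commute)

lemma bounded_bilinear_hessian_form: "bounded_bilinear (hessian_form A x)"
  unfolding bilinear_conv_bounded_bilinear[symmetric] bilinear_def
  by (intro conjI allI linearI; simp add: hessian_form_def fprod_deriv.add_left fprod_deriv.add_right
      fprod_deriv.scaleR_left fprod_deriv.scaleR_right inner_add_left inner_add_right algebra_simps)

lemma partial_deriv_partial_deriv_loss:
  "partial_deriv b (partial_deriv c (loss A)) x = hessian_form A x b c"
proof -
  have "((\<lambda>t. - 2 * ((A - fprod (x + t *\<^sub>R b)) \<bullet> fprod_deriv (x + t *\<^sub>R b) c))
      has_real_derivative hessian_form A x b c) (at 0)"
    unfolding fprod_add_scaleR fprod_deriv.add_left fprod_deriv.scaleR_left inner_diff_left inner_add_left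
      inner_add_right inner_scaleR_left inner_scaleR_right hessian_form_def
    by (auto intro!: derivative_eq_intros simp: algebra_simps)
  then show ?thesis
    unfolding partial_deriv_def[of b] partial_deriv_loss by (rule DERIV_imp_deriv)
qed

section \<open>From negative curvature to a negative eigenvalue\<close>

lemma linear_coeff_zero_of_nonneg:
  fixes a c :: real
  assumes "\<And>t. 0 \<le> 2 * t * a + t\<^sup>2 * c"
  shows "a = 0"
proof (rule ccontr)
  assume a: "a \<noteq> 0"
  \<comment> \<open>Positive and larger than \<open>c\<close>, so that at \<open>t = - a / d\<close>
    the linear term outweighs the quadratic one.\<close>
  define d where "d = \<bar>c\<bar> + 1"
  have d: "d > 0" "c < d" by (auto simp: d_def)
  have "0 \<le> 2 * (- a / d) * a + (- a / d)\<^sup>2 * c" by (rule assms)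
  also have "\<dots> = (a / d)\<^sup>2 * (c - 2 * d)"
    using d by (simp add: field_simps power2_eq_square)
  finally have "0 \<le> c - 2 * d" using a d by (simp add: zero_le_mult_iff)
  then show False using d by simp
qed

text \<open>The minimiser of the form on the unit sphere of the subspace is an eigenvector.\<close>

lemma symmetric_form_negative_eigenvector:
  fixes B :: "'a::euclidean_space \<Rightarrow> 'a \<Rightarrow> real"
  assumes B: "bounded_bilinear B" and sym: "\<And>v w. B v w = B w v" and S: "subspace S"
    and neg: "v \<in> S" "B v v < 0"
  obtains \<mu> u where "\<mu> < 0" "u \<in> S" "u \<noteq> 0" "\<And>w. w \<in> S \<Longrightarrow> B u w = \<mu> * (u \<bullet> w)"
proof -
  interpret bounded_bilinear B by (rule B)
  have "v \<noteq> 0" using neg by (auto simp: zero_left)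
  then have v: "(1 / norm v) *\<^sub>R v \<in> S \<inter> sphere 0 1"
    using neg S by (auto simp: subspace_scale)
  have "compact (S \<inter> sphere 0 1)"
    using S by (intro closed_Int_compact closed_subspace) auto
  moreover have "continuous_on (S \<inter> sphere 0 1) (\<lambda>x. B x x)"
    by (intro continuous_on continuous_on_id)
  ultimately obtain u where u: "u \<in> S \<inter> sphere 0 1" "\<And>w. w \<in> S \<inter> sphere 0 1 \<Longrightarrow> B u u \<le> B w w"
    using continuous_attains_inf[of "S \<inter> sphere 0 1"] v by blast
  define \<mu> where "\<mu> = B u u"
  have "\<mu> \<le> B v v / (norm v)\<^sup>2"
    using u(2)[OF v] by (simp add: \<mu>_def scaleR_left scaleR_right power2_eq_square)
  also have "\<dots> < 0" using neg \<open>v \<noteq> 0\<close> by (simp add: divide_neg_pos)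
  finally have "\<mu> < 0" .
  have ge: "\<mu> * (w \<bullet> w) \<le> B w w" if "w \<in> S" for w
  proof (cases "w = 0")
    case False
    then have "(1 / norm w) *\<^sub>R w \<in> S \<inter> sphere 0 1"
      using that S by (auto simp: subspace_scale)
    from u(2)[OF this] have "\<mu> \<le> B w w / (norm w)\<^sup>2"
      by (simp add: \<mu>_def scaleR_left scaleR_right power2_eq_square)
    then show ?thesis using False by (simp add: field_simps power2_norm_eq_inner)
  qed (simp add: zero_left)
  have eq: "B u w = \<mu> * (u \<bullet> w)" if "w \<in> S" for w
  proof -
    \<comment> \<open>Apply \<open>ge\<close> to \<open>u + t *\<^sub>R w\<close>; the constant
      terms cancel because \<open>u\<close> is a unit vector with
      \<open>B u u = \<mu>\<close>.\<close>
    have "0 \<le> 2 * t * (B u w - \<mu> * (u \<bullet> w)) + t\<^sup>2 * (B w w - \<mu> * (w \<bullet> w))" for t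
    proof -
      have "u + t *\<^sub>R w \<in> S" using u(1) that S by (simp add: subspace_add subspace_scale)
      from ge[OF this] show ?thesis
        using u(1) sym[of w u]
        by (simp add: add_left add_right scaleR_left scaleR_right inner_add_left inner_add_right
            inner_commute[of w u] \<mu>_def[symmetric] norm_eq_1 algebra_simps power2_eq_square)
    qed
    then have "B u w - \<mu> * (u \<bullet> w) = 0" by (rule linear_coeff_zero_of_nonneg)
    then show ?thesis by simp
  qed
  have "u \<noteq> 0" using u(1) by auto
  with that \<open>\<mu> < 0\<close> u(1) eq show ?thesis by blast
qed

text \<open>A standard basis vector is either feasible or reads off an entry that feasibility forces
  to be zero.\<close>

lemma feasible_representation:
  fixes v :: "(real^'r::finite^'m::finite) \<times> (real^'r^'n::finite)"
  assumes "v \<in> feasible I J"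
  shows "(\<Sum>b\<in>feasible I J \<inter> Basis. (v \<bullet> b) *\<^sub>R b) = v"
proof -
  have basis: "(axis i (axis k 1), 0) \<in> feasible I J \<longleftrightarrow> (i, k) \<in> I"
      "(0, axis j (axis k 1)) \<in> feasible I J \<longleftrightarrow> (j, k) \<in> J" for i j k
    by (auto simp: feasible_iff axis_def)
  have "v \<bullet> b = 0" if "b \<in> Basis" "b \<notin> feasible I J" for b
    using that assms basis unfolding feasible_iff[of v]
    by (auto simp: Basis_prod_def Basis_vec_def inner_axis inner_prod_def)
  then have "(\<Sum>b\<in>feasible I J \<inter> Basis. (v \<bullet> b) *\<^sub>R b) = (\<Sum>b\<in>Basis. (v \<bullet> b) *\<^sub>R b)"
    by (intro sum.mono_neutral_left) auto
  then show ?thesis by (simp add: euclidean_representation)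
qed

lemma hessian_loss:
  assumes "v \<in> feasible I J"
  shows "hessian (feasible I J) (loss A) x v =
    (\<Sum>b\<in>feasible I J \<inter> Basis. hessian_form A x v b *\<^sub>R b)"
proof -
  interpret H: bounded_bilinear "hessian_form A x" by (rule bounded_bilinear_hessian_form)
  have "(\<Sum>c\<in>feasible I J \<inter> Basis. hessian_form A x b c * (v \<bullet> c)) = hessian_form A x v b" for b
    by (subst (2) feasible_representation[OF assms, symmetric])
      (simp add: H.sum_left H.scaleR_left hessian_form_commute[of A x b] mult.commute)
  then show ?thesis
    by (simp add: hessian_def partial_deriv_partial_deriv_loss)
qed

text \<open>The hypothesis says that the form is negative at \<open>v\<close>. Its minimizer
  \<open>u\<close> on the unit sphere satisfies an eigenvalue equation tested against feasible
  vectors, and testing with coordinate directions recovers the equation for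
  \<open>hessian\<close>.\<close>

lemma negative_hessian_eigenvalue:
  assumes v: "v \<in> feasible I J" and neg: "(norm (fprod_deriv x v))\<^sup>2 < 2 * ((A - fprod x) \<bullet> fprod v)"
  shows "\<exists>\<mu><0. hessian_eigenvalue (feasible I J) (loss A) x \<mu>"
proof -
  have "hessian_form A x v v < 0"
    using neg by (simp add: hessian_form_def fprod_deriv_self power2_norm_eq_inner)
  then obtain \<mu> u where \<mu>: "\<mu> < 0" and u: "u \<in> feasible I J" "u \<noteq> 0"
      "\<And>w. w \<in> feasible I J \<Longrightarrow> hessian_form A x u w = \<mu> * (u \<bullet> w)"
    using symmetric_form_negative_eigenvector[OF bounded_bilinear_hessian_form hessian_form_commute
        subspace_feasible v] by metis
  have "hessian (feasible I J) (loss A) x u =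
      (\<Sum>b\<in>feasible I J \<inter> Basis. \<mu> *\<^sub>R ((u \<bullet> b) *\<^sub>R b))"
    unfolding hessian_loss[OF u(1)] by (intro sum.cong) (auto simp: u(3))
  also have "\<dots> = \<mu> *\<^sub>R u"
    by (simp only: scaleR_sum_right[symmetric] feasible_representation[OF u(1)])
  finally show ?thesis using \<mu> u by (auto simp: hessian_eigenvalue_def)
qed

text \<open>The derivative within the feasible set restricts to the line through \<open>x\<close> in
  direction \<open>v\<close>, where it must equal the derivative already computed.\<close>

lemma critical_point_loss_imp:
  assumes crit: "critical_point (feasible I J) (loss A) x" and v: "v \<in> feasible I J"
  shows "(A - fprod x) \<bullet> fprod_deriv x v = 0"
proof -
  have x: "x \<in> feasible I J" and der: "(loss A has_derivative (\<lambda>_. 0)) (at x within feasible I J)"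
    using crit by (auto simp: critical_point_def)
  have "range (\<lambda>t. x + t *\<^sub>R v) \<subseteq> feasible I J"
    using x v by (intro image_subsetI feasible_add feasible_scaleR)
  then have "(loss A has_derivative (\<lambda>_. 0)) (at (x + 0 *\<^sub>R v) within range (\<lambda>t. x + t *\<^sub>R v))"
    using has_derivative_subset[OF der] by simp
  moreover have "((\<lambda>t. x + t *\<^sub>R v) has_derivative (\<lambda>t. t *\<^sub>R v)) (at 0)"
    by (auto intro!: derivative_eq_intros)
  ultimately have "((\<lambda>t. loss A (x + t *\<^sub>R v)) has_derivative (\<lambda>_. 0)) (at 0)"
    using has_derivative_in_compose[of "\<lambda>t. x + t *\<^sub>R v" _ 0 UNIV "loss A" "\<lambda>_. 0"] by blast
  then have "((\<lambda>t. loss A (x + t *\<^sub>R v)) has_real_derivative 0) (at 0)"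
    by (simp add: has_field_derivative_def lambda_zero)
  from DERIV_unique[OF this loss_line_has_derivative] show ?thesis by simp
qed

section \<open>Descent at points that are not global minimizers\<close>

lemma descent_direction:
  fixes I :: "('m::finite \<times> 'r::finite) set" and J :: "('n::finite \<times> 'r) set" and A :: "real^'n^'m"
  assumes dis: "disjoint (range (rank_one_support I J))"
    and x: "x \<in> feasible I J" and ng: "\<not> global_minimizer (feasible I J) (loss A) x"
  obtains v where "v \<in> feasible I J" "\<forall>\<^sub>F t in at_right 0. loss A (x + t *\<^sub>R v) < loss A x"
proof (cases "\<forall>v \<in> feasible I J. (A - fprod x) \<bullet> fprod_deriv x v = 0")
  case True
  then obtain v where v: "v \<in> feasible I J"
      and neg: "(norm (fprod_deriv x v))\<^sup>2 < 2 * ((A - fprod x) \<bullet> fprod v)"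
    using second_order_imp_global_minimizer[OF dis x, of A] ng by (meson not_le)
  \<comment> \<open>The increment of the loss divided by \<open>t\<^sup>2\<close>; the linear term
    is absent by stationarity.\<close>
  define g where "g t = (norm (fprod_deriv x v))\<^sup>2 - 2 * ((A - fprod x) \<bullet> fprod v)
      + 2 * t * (fprod_deriv x v \<bullet> fprod v) + t\<^sup>2 * (norm (fprod v))\<^sup>2" for t
  have loss: "loss A (x + t *\<^sub>R v) = loss A x + t\<^sup>2 * g t" for t
    using True v
    by (simp add: loss_add_scaleR g_def algebra_simps power2_eq_square power3_eq_cube power4_eq_xxxx)
  have "(g \<longlongrightarrow> g 0) (at_right 0)"
    unfolding g_def by (intro tendsto_intros)
  moreover have "g 0 < 0" using neg by (simp add: g_def)
  ultimately have "\<forall>\<^sub>F t in at_right 0. g t < 0" by (rule order_tendstoD)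
  moreover have "\<forall>\<^sub>F t::real in at_right 0. 0 < t" by (rule eventually_at_right_less)
  ultimately have "\<forall>\<^sub>F t in at_right 0. loss A (x + t *\<^sub>R v) < loss A x"
    by eventually_elim (simp add: loss mult_pos_neg)
  with v that show ?thesis by blast
next
  case False
  then obtain w where w: "w \<in> feasible I J" "(A - fprod x) \<bullet> fprod_deriv x w \<noteq> 0" by blast
  \<comment> \<open>Scaling \<open>w\<close> by its own first-order coefficient makes that
    coefficient a nonzero square, so the slope is negative whatever its original sign.\<close>
  define v where "v = ((A - fprod x) \<bullet> fprod_deriv x w) *\<^sub>R w"
  have v: "v \<in> feasible I J" using w by (simp add: v_def feasible_scaleR)
  have "- 2 * ((A - fprod x) \<bullet> fprod_deriv x v) < 0"
    using w by (auto simp: v_def fprod_deriv.scaleR_right zero_less_mult_iff linorder_neq_iff)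
  from DERIV_neg_dec_right[OF loss_line_has_derivative this]
  obtain d where "d > 0" "\<forall>t>0. t < d \<longrightarrow> loss A (x + t *\<^sub>R v) < loss A x" by auto
  then have "\<forall>\<^sub>F t in at_right 0. loss A (x + t *\<^sub>R v) < loss A x"
    by (auto simp: eventually_at_right_field)
  with v that show ?thesis by blast
qed

lemma no_spurious_local_minimum:
  fixes I :: "('m::finite \<times> 'r::finite) set" and J :: "('n::finite \<times> 'r) set" and A :: "real^'n^'m"
  assumes dis: "disjoint (range (rank_one_support I J))"
  shows "\<not> spurious_local_minimum (feasible I J) (loss A) x"
proof
  assume "spurious_local_minimum (feasible I J) (loss A) x"
  then have x: "x \<in> feasible I J" and ng: "\<not> global_minimizer (feasible I J) (loss A) x"
      and loc: "\<forall>\<^sub>F y in at x within feasible I J. loss A x \<le> loss A y"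
    by (auto simp: spurious_local_minimum_def local_minimizer_def)
  obtain v where v: "v \<in> feasible I J" and desc: "\<forall>\<^sub>F t in at_right 0. loss A (x + t *\<^sub>R v) < loss A x"
    using descent_direction[OF dis x ng] .
  have "((\<lambda>t. x + t *\<^sub>R v) \<longlongrightarrow> x + 0 *\<^sub>R v) (at_right 0)"
    by (intro tendsto_intros)
  \<comment> \<open>The strict decrease of the loss shows that these points differ from
    \<open>x\<close>.\<close>
  moreover have "\<forall>\<^sub>F t in at_right 0. x + t *\<^sub>R v \<in> feasible I J \<and> x + t *\<^sub>R v \<noteq> x"
    using desc
  proof eventually_elim
    case (elim t)
    then show ?case
      using x v by (auto intro: feasible_add feasible_scaleR)
  qed
  ultimately have "filterlim (\<lambda>t. x + t *\<^sub>R v) (at x within feasible I J) (at_right 0)"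
    by (simp add: filterlim_at)
  from eventually_compose_filterlim[OF loc this] desc
  have "\<forall>\<^sub>F t in at_right (0::real). False" by eventually_elim simp
  then show False by (simp add: trivial_limit_at_right_real)
qed

section \<open>Paths inside sublevel sets\<close>

text \<open>The loss is constant on a fiber, so a path inside it stays in every sublevel set that
  contains its start.\<close>

definition fiber :: "('m::finite \<times> 'r::finite) set \<Rightarrow> ('n::finite \<times> 'r) set \<Rightarrow> real^'n^'m \<Rightarrow> ((real^'r^'m) \<times> (real^'r^'n)) set" where
  "fiber I J M = {z \<in> feasible I J. fprod z = M}"

lemma closed_segment_add:
  "closed_segment x (x + w) = (\<lambda>t. x + t *\<^sub>R w) ` {0..1}" for w :: "'a::real_vector"
  unfolding closed_segment_image_interval by (intro image_cong) (auto simp: algebra_simps)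

text \<open>The two equations remove the linear and the quadratic term of the product along the
  segment.\<close>

lemma path_component_fiber_add:
  assumes "x \<in> feasible I J" "w \<in> feasible I J" "fprod_deriv x w = 0" "fprod w = 0"
  shows "path_component (fiber I J (fprod x)) x (x + w)"
proof (rule path_component_linepath)
  show "closed_segment x (x + w) \<subseteq> fiber I J (fprod x)"
    unfolding closed_segment_add
    by (rule image_subsetI) (simp add: fiber_def fprod_add_scaleR assms feasible_add feasible_scaleR)
qed

definition rescale :: "'r \<Rightarrow> real \<Rightarrow> (real^'r^'m) \<times> (real^'r^'n) \<Rightarrow> (real^'r^'m) \<times> (real^'r^'n)" where
  "rescale k s x = (\<chi> i l. if l = k then s * fst x $ i $ l else fst x $ i $ l,
     \<chi> j l. if l = k then snd x $ j $ l / s else snd x $ j $ l)"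

lemma column_rescale:
  "column l (fst (rescale k s x)) = (if l = k then s *\<^sub>R column l (fst x) else column l (fst x))"
  "column l (snd (rescale k s x)) = (if l = k then (1 / s) *\<^sub>R column l (snd x) else column l (snd x))"
  by (simp_all add: rescale_def column_def vec_eq_iff)

lemma rescale_one: "rescale k 1 x = x"
  by (simp add: rescale_def prod_eq_iff vec_eq_iff)

lemma rescale_in_fiber:
  assumes "x \<in> feasible I J" "s > 0"
  shows "rescale k s x \<in> fiber I J (fprod x)"
proof -
  have "rescale k s x \<in> feasible I J"
    using assms by (simp add: feasible_iff rescale_def)
  moreover have "fprod (rescale k s x) = fprod x"
    unfolding vec_eq_iff fprod_nth using assms(2)
    by (auto simp: rescale_def intro!: sum.cong)
  ultimately show ?thesis by (simp add: fiber_def)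
qed

text \<open>The factor moves within the positive half-line, which is convex and contains 1, where
  \<open>rescale\<close> is the identity.\<close>

lemma path_component_fiber_rescale:
  assumes x: "x \<in> feasible I J" and s: "s > 0"
  shows "path_component (fiber I J (fprod x)) x (rescale k s x)"
proof -
  have "continuous_on {0<..} (\<lambda>s. if b then s * c else c)"
       "continuous_on {0<..} (\<lambda>s. if b then c / s else c)" for b and c :: real
    by (cases b; auto intro!: continuous_intros)+
  then have "continuous_on {0<..} (\<lambda>s. rescale k s x)"
    unfolding rescale_def by (intro continuous_intros)
  then have "path_connected ((\<lambda>s. rescale k s x) ` {0<..})"
    by (intro path_connected_continuous_image convex_imp_path_connected) auto
  then have "path_component ((\<lambda>s. rescale k s x) ` {0<..}) (rescale k 1 x) (rescale k s x)"
    using s unfolding path_connected_component by auto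
  then show ?thesis
    unfolding rescale_one
    by (rule path_component_of_subset[rotated]) (use rescale_in_fiber[OF x] in auto)
qed

text \<open>
  Finer than \<^const>\<open>support_rel\<close>: an empty rank-one support can arise from different column supports.
\<close>

definition same_support :: "('m \<times> 'r) set \<Rightarrow> ('n \<times> 'r) set \<Rightarrow> 'r \<Rightarrow> 'r \<Rightarrow> bool" where
  "same_support I J k l \<longleftrightarrow> (\<forall>i. (i, k) \<in> I \<longleftrightarrow> (i, l) \<in> I) \<and> (\<forall>j. (j, k) \<in> J \<longleftrightarrow> (j, l) \<in> J)"

text \<open>\<open>K\<close> holds the columns treated so far. Orthogonality is asked only between
  equal column supports, where linear combinations stay feasible. For a zero column the partner must
  vanish too, since the product would not bound it.\<close>

definition orthonormalized :: "('m::finite \<times> 'r::finite) set \<Rightarrow> ('n::finite \<times> 'r) set \<Rightarrow> 'r set \<Rightarrow>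
    (real^'r^'m) \<times> (real^'r^'n) \<Rightarrow> bool" where
  "orthonormalized I J K x \<longleftrightarrow>
     (\<forall>k\<in>K. norm (column k (fst x)) = 1 \<or> column k (fst x) = 0 \<and> column k (snd x) = 0) \<and>
     (\<forall>k\<in>K. \<forall>l\<in>K. k \<noteq> l \<longrightarrow> same_support I J k l \<longrightarrow> column k (fst x) \<bullet> column l (fst x) = 0)"

lemma column_add: "column k (M + N) = column k M + column k N"
  by (simp add: column_def vec_eq_iff)

lemma column_zero [simp]: "column k 0 = 0"
  by (simp add: column_def vec_eq_iff)

text \<open>
  Subtracting \<open>c\<^sub>l x\<^sub>l\<close> from \<open>x\<^sub>k\<close> is compensated by adding \<open>c\<^sub>l y\<^sub>k\<close> to \<open>y\<^sub>l\<close>; the product is constant on the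
  whole segment because \<open>c\<^sub>k = 0\<close>.
\<close>

lemma orthogonalize_step:
  fixes I :: "('m::finite \<times> 'r::finite) set" and J :: "('n::finite \<times> 'r) set"
  assumes y: "y \<in> feasible I J" and on: "orthonormalized I J K y" and k: "k \<notin> K"
  obtains z where "path_component (fiber I J (fprod y)) y z" "orthonormalized I J K z"
    "\<And>l. l \<in> K \<Longrightarrow> same_support I J k l \<Longrightarrow> column k (fst z) \<bullet> column l (fst z) = 0"
proof -
  define a where "a l = column l (fst y)" for l
  define b where "b l = column l (snd y)" for l
  define c where "c l = (if l \<in> K \<and> same_support I J k l then a k \<bullet> a l else 0)" for l
  define w where "w = (cols {k} (\<lambda>_. - (\<Sum>l\<in>UNIV. c l *\<^sub>R a l)), cols UNIV (\<lambda>l. c l *\<^sub>R b k))"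
  have ck: "c k = 0" using k by (simp add: c_def)
  \<comment> \<open>A nonzero \<open>c l\<close> forces \<open>l\<close> to share both column
    supports with \<open>k\<close>, which keeps the combinations feasible.\<close>
  have "c l * fst y $ i $ l = 0" if "(i, k) \<notin> I" for i l
    using that y by (auto simp: c_def same_support_def feasible_iff)
  moreover have "c l * snd y $ j $ k = 0" if "(j, l) \<notin> J" for j l
    using that y by (auto simp: c_def same_support_def feasible_iff)
  ultimately have w: "w \<in> feasible I J"
    by (auto simp: feasible_iff w_def cols_def a_def b_def column_def intro!: sum.neutral)
  have "fprod_deriv y w = 0"
    by (simp add: fprod_deriv_def w_def cols_mult_transpose outer_scaleR flip: a_def b_def)
      (simp add: vec_eq_iff sum_distrib_right sum_distrib_left mult_ac)
  moreover have "fprod w = 0"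
    by (simp add: fprod_def w_def cols_mult_transpose(1) column_cols ck)
  ultimately have path: "path_component (fiber I J (fprod y)) y (y + w)"
    by (rule path_component_fiber_add[OF y w])
  have fst_col: "column l (fst (y + w)) = (if l = k then a k - (\<Sum>l\<in>UNIV. c l *\<^sub>R a l) else a l)"
    and snd_col: "column l (snd (y + w)) = b l + c l *\<^sub>R b k" for l
    by (auto simp: column_add w_def column_cols a_def b_def)
  show ?thesis
  proof (rule that[OF path])
    have "c l = 0" if "l \<in> K" "a l = 0" for l using that by (simp add: c_def)
    moreover have "l \<noteq> k" if "l \<in> K" for l using that k by auto
    ultimately show "orthonormalized I J K (y + w)"
      using on unfolding orthonormalized_def fst_col snd_col by (auto simp: a_def b_def)
    fix m assume m: "m \<in> K" "same_support I J k m"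
    \<comment> \<open>Only \<open>l = m\<close> survives by orthogonality; there \<open>a m\<close>
      is a unit vector, or zero and both sides vanish.\<close>
    have "c l * (a l \<bullet> a m) = (if l = m then a k \<bullet> a m else 0)" for l
    proof (cases "l \<in> K \<and> same_support I J k l")
      case True
      then have "same_support I J l m" using m by (simp add: same_support_def)
      then show ?thesis
        using True m on by (auto simp: c_def orthonormalized_def norm_eq_1 simp flip: a_def)
    qed (use m in \<open>auto simp: c_def\<close>)
    then have "(\<Sum>l\<in>UNIV. c l *\<^sub>R a l) \<bullet> a m = a k \<bullet> a m"
      by (simp add: inner_sum_left)
    then show "column k (fst (y + w)) \<bullet> column m (fst (y + w)) = 0"
      using m k unfolding fst_col by (auto simp: inner_diff_left)
  qed
qed

text \<open>Gram-Schmidt by induction: column \<open>k\<close> is made orthogonal to the treated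
  ones, then rescaled to unit length, or its partner is erased if it became zero.\<close>

lemma path_to_orthonormalized:
  fixes I :: "('m::finite \<times> 'r::finite) set" and J :: "('n::finite \<times> 'r) set"
  assumes x: "x \<in> feasible I J" and "finite K"
  shows "\<exists>y. path_component (fiber I J (fprod x)) x y \<and> orthonormalized I J K y"
  using assms(2)
proof (induction K)
  case empty
  have "path_component (fiber I J (fprod x)) x x"
    using x by (intro path_component_refl) (simp add: fiber_def)
  then show ?case by (intro exI[of _ x]) (simp add: orthonormalized_def)
next
  case (insert k K)
  then obtain y where y: "path_component (fiber I J (fprod x)) x y" "orthonormalized I J K y" by blast
  then have yf: "y \<in> feasible I J" "fprod y = fprod x"
    using path_component_mem(2)[OF y(1)] by (auto simp: fiber_def)
  obtain z where z: "path_component (fiber I J (fprod x)) y z" "orthonormalized I J K z"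
      "\<And>l. l \<in> K \<Longrightarrow> same_support I J k l \<Longrightarrow> column k (fst z) \<bullet> column l (fst z) = 0"
    using orthogonalize_step[OF yf(1) y(2) insert.hyps(2)] unfolding yf(2) by metis
  have zf: "z \<in> feasible I J" "fprod z = fprod x"
    using path_component_mem(2)[OF z(1)] by (auto simp: fiber_def)
  have "\<exists>z'. path_component (fiber I J (fprod x)) z z' \<and> orthonormalized I J (insert k K) z'"
  proof (cases "column k (fst z) = 0")
    case True
    \<comment> \<open>Column \<open>k\<close> of the first factor is zero, so its partner can be
      shrunk to zero without changing the product.\<close>
    define w where "w = (0 :: real^'r^'m, cols {k} (\<lambda>_. - column k (snd z)))"
    have w: "w \<in> feasible I J"
      using zf by (auto simp: w_def feasible_iff cols_def column_def)
    have "fprod_deriv z w = 0" "fprod w = 0"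
      using True by (auto simp: fprod_deriv_def fprod_def w_def cols_mult_transpose)
    from path_component_fiber_add[OF zf(1) w this]
    have "path_component (fiber I J (fprod x)) z (z + w)" by (simp add: zf(2))
    moreover have "column l (fst (z + w)) = column l (fst z)"
      "column l (snd (z + w)) = (if l = k then 0 else column l (snd z))" for l
      by (auto simp: w_def column_add column_cols)
    then have "orthonormalized I J (insert k K) (z + w)"
      using z(2) True by (auto simp: orthonormalized_def)
    ultimately show ?thesis by blast
  next
    case False
    define s where "s = 1 / norm (column k (fst z))"
    have s: "s > 0" using False by (simp add: s_def)
    have "path_component (fiber I J (fprod x)) z (rescale k s z)"
      using path_component_fiber_rescale[OF zf(1) s] by (simp add: zf(2))
    moreover have "orthonormalized I J (insert k K) (rescale k s z)"
      unfolding orthonormalized_def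
    proof (intro conjI ballI impI)
      fix l assume "l \<in> insert k K"
      then show "norm (column l (fst (rescale k s z))) = 1 \<or>
          column l (fst (rescale k s z)) = 0 \<and> column l (snd (rescale k s z)) = 0"
        using z(2) False unfolding orthonormalized_def column_rescale by (cases "l = k") (auto simp: s_def)
    next
      fix l m assume lm: "l \<in> insert k K" "m \<in> insert k K" "l \<noteq> m" "same_support I J l m"
      have "same_support I J m l" using lm(4) by (auto simp: same_support_def)
      then have "column l (fst z) \<bullet> column m (fst z) = 0"
        using lm z(2,3) unfolding orthonormalized_def by (metis inner_commute insertE)
      then show "column l (fst (rescale k s z)) \<bullet> column m (fst (rescale k s z)) = 0"
        using lm(3) by (auto simp: column_rescale)
    qed
    ultimately show ?thesis by blast
  qed
  then show ?case
    using path_component_trans[OF path_component_trans[OF y(1) z(1)]] by blast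
qed

section \<open>Bounded representatives and compactness\<close>

lemma norm_matrix_square_columns: "(norm M)\<^sup>2 = (\<Sum>k\<in>UNIV. (norm (column k M))\<^sup>2)" for M :: "real^'r^'m"
  unfolding power2_norm_eq_inner inner_vec_def column_def by simp (rule sum.swap)

text \<open>In the Gram expansion of the squared norm of the product all off-diagonal terms vanish,
  by orthogonality for equal column supports and by disjointness otherwise. The diagonal is the
  squared norm of the second factor, while the first has columns of norm at most 1.\<close>

lemma norm_orthonormalized_le:
  fixes I :: "('m::finite \<times> 'r::finite) set" and J :: "('n::finite \<times> 'r) set"
  assumes dis: "disjoint (range (rank_one_support I J))"
    and y: "y \<in> feasible I J" and on: "orthonormalized I J UNIV y"
  shows "(norm y)\<^sup>2 \<le> CARD('r) + (norm (fprod y))\<^sup>2"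
proof -
  let ?a = "\<lambda>k. column k (fst y)" and ?b = "\<lambda>k. column k (snd y)"
  have unit: "norm (?a k) = 1 \<or> ?a k = 0 \<and> ?b k = 0" for k
    using on by (simp add: orthonormalized_def)
  have off: "(?a k \<bullet> ?a l) * (?b k \<bullet> ?b l) = 0" if "k \<noteq> l" for k l
  proof (cases "same_support I J k l")
    case True
    then show ?thesis using on that by (simp add: orthonormalized_def)
  next
    case False
    have "rank_one_support I J k \<inter> rank_one_support I J l = {}"
    \<comment> \<open>Equal rank-one supports with different column supports can only be
      empty.\<close>
    proof (cases "rank_one_support I J k = rank_one_support I J l")
      case True
      then show ?thesis
        using False by (auto simp: rank_one_support_def times_eq_iff same_support_def)
    next
      case False
      then show ?thesis using dis by (auto simp: disjoint_def)
    qed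
    then have "(\<forall>i. (i, k) \<notin> I \<or> (i, l) \<notin> I) \<or> (\<forall>j. (j, k) \<notin> J \<or> (j, l) \<notin> J)"
      by (auto simp: rank_one_support_def)
    then show ?thesis
    proof
      assume "\<forall>i. (i, k) \<notin> I \<or> (i, l) \<notin> I"
      then have "fst y $ i $ k * fst y $ i $ l = 0" for i
        using y unfolding feasible_iff by (metis mult_eq_0_iff)
      then have "?a k \<bullet> ?a l = 0"
        unfolding inner_vec_def column_def by (intro sum.neutral) simp
      then show ?thesis by simp
    next
      assume "\<forall>j. (j, k) \<notin> J \<or> (j, l) \<notin> J"
      then have "snd y $ j $ k * snd y $ j $ l = 0" for j
        using y unfolding feasible_iff by (metis mult_eq_0_iff)
      then have "?b k \<bullet> ?b l = 0"
        unfolding inner_vec_def column_def by (intro sum.neutral) simp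
      then show ?thesis by simp
    qed
  qed
  have "(norm (fprod y))\<^sup>2 = (\<Sum>k\<in>UNIV. \<Sum>l\<in>UNIV. (?a k \<bullet> ?a l) * (?b k \<bullet> ?b l))"
    by (simp add: fprod_def matrix_mult_transpose_columns power2_norm_eq_inner inner_sum_left
        inner_sum_right inner_outer_outer) (rule sum.swap)
  also have "\<dots> = (\<Sum>k\<in>UNIV. \<Sum>l\<in>UNIV. if l = k then (norm (?b k))\<^sup>2 else 0)"
  proof (intro sum.cong refl)
    fix k l
    show "(?a k \<bullet> ?a l) * (?b k \<bullet> ?b l) = (if l = k then (norm (?b k))\<^sup>2 else 0)"
      using off[of k l] unit[of k] by (cases "l = k") (auto simp: norm_eq_1 power2_norm_eq_inner)
  qed
  also have "\<dots> = (norm (snd y))\<^sup>2"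
    by (simp add: norm_matrix_square_columns)
  finally have "(norm (fprod y))\<^sup>2 = (norm (snd y))\<^sup>2" .
  moreover have "(norm (fst y))\<^sup>2 \<le> (\<Sum>k\<in>(UNIV :: 'r set). 1)"
    unfolding norm_matrix_square_columns
  proof (rule sum_mono)
    fix k show "(norm (?a k))\<^sup>2 \<le> 1" using unit[of k] by auto
  qed
  ultimately show ?thesis by (simp add: norm_prod_def)
qed

lemma continuous_on_loss:
  fixes A :: "real^'n^'m" and T :: "((real^'r^'m) \<times> (real^'r^'n)) set"
  shows "continuous_on T (loss A)"
proof -
  have "fprod x = (1 / 2) *\<^sub>R fprod_deriv x x" for x :: "(real^'r^'m) \<times> (real^'r^'n)"
    by (simp add: fprod_deriv_self)
  then have "continuous_on T (fprod :: (real^'r^'m) \<times> (real^'r^'n) \<Rightarrow> _)"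
    by (simp add: continuous_on_scaleR fprod_deriv.continuous_on continuous_on_const continuous_on_id)
  then show ?thesis
    unfolding loss_eq by (intro continuous_intros)
qed

text \<open>The sublevel bounds the product by the triangle inequality, and an orthonormalized point
  of the fiber is bounded by its product. The radius does not depend on \<open>y\<close>.\<close>

lemma sublevel_bounded_representative:
  fixes I :: "('m::finite \<times> 'r::finite) set" and J :: "('n::finite \<times> 'r) set"
  assumes dis: "disjoint (range (rank_one_support I J))"
    and y: "y \<in> sublevel (feasible I J) (loss A) \<alpha>"
  obtains z where "path_component (sublevel (feasible I J) (loss A) \<alpha>) y z" "loss A z = loss A y"
    "norm z \<le> sqrt (CARD('r) + (norm A + sqrt \<alpha>)\<^sup>2)"
proof -
  have yf: "y \<in> feasible I J" and ly: "loss A y \<le> \<alpha>" using y by (auto simp: sublevel_def)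
  obtain z where z: "path_component (fiber I J (fprod y)) y z" "orthonormalized I J UNIV z"
    using path_to_orthonormalized[OF yf, of UNIV] by auto
  have zf: "z \<in> feasible I J" "fprod z = fprod y"
    using path_component_mem(2)[OF z(1)] by (auto simp: fiber_def)
  have "fiber I J (fprod y) \<subseteq> sublevel (feasible I J) (loss A) \<alpha>"
    using ly by (auto simp: fiber_def sublevel_def loss_eq)
  then have "path_component (sublevel (feasible I J) (loss A) \<alpha>) y z"
    using z(1) by (rule path_component_of_subset)
  moreover have "norm (A - fprod y) \<le> sqrt \<alpha>"
    using ly unfolding loss_eq by (rule real_le_rsqrt)
  then have "norm (fprod y) \<le> norm A + sqrt \<alpha>"
    using norm_triangle_ineq4[of A "A - fprod y"] by simp
  then have "(norm (fprod z))\<^sup>2 \<le> (norm A + sqrt \<alpha>)\<^sup>2"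
    unfolding zf(2) by (intro power_mono) auto
  then have "norm z \<le> sqrt (CARD('r) + (norm A + sqrt \<alpha>)\<^sup>2)"
    using norm_orthonormalized_le[OF dis zf(1) z(2)] by (intro real_le_rsqrt) linarith
  moreover have "loss A z = loss A y" by (simp add: loss_eq zf(2))
  ultimately show ?thesis using that by blast
qed

text \<open>The loss attains its infimum over \<open>V\<close> at a point \<open>y\<close> of the
  closure. Showing that \<open>y\<close> lies in \<open>V\<close> contradicts
  \<open>descend\<close>.\<close>

lemma no_spurious_local_valley:
  fixes I :: "('m::finite \<times> 'r::finite) set" and J :: "('n::finite \<times> 'r) set" and A :: "real^'n^'m"
  assumes dis: "disjoint (range (rank_one_support I J))"
  shows "\<not> spurious_local_valley (feasible I J) (loss A) V"
proof
  assume "spurious_local_valley (feasible I J) (loss A) V"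
  then obtain \<alpha> x where x: "x \<in> sublevel (feasible I J) (loss A) \<alpha>"
      and V: "V = path_component_set (sublevel (feasible I J) (loss A) \<alpha>) x"
      and ng: "\<And>y. y \<in> V \<Longrightarrow> \<not> global_minimizer (feasible I J) (loss A) y"
    by (auto simp: spurious_local_valley_def local_valley_def)
  let ?E = "sublevel (feasible I J) (loss A) \<alpha>"
  have VE: "V \<subseteq> ?E" unfolding V by (rule path_component_subset)
  have xV: "x \<in> V" using x by (simp add: V path_component_refl)
  have V_trans: "z \<in> V" if "y \<in> V" "path_component ?E y z" for y z
    using that by (auto simp: V intro: path_component_trans)
  have descend: "\<exists>z\<in>V. loss A z < loss A y" if y: "y \<in> V" for y
  proof -
    have yf: "y \<in> feasible I J" and ly: "loss A y \<le> \<alpha>" using y VE by (auto simp: sublevel_def)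
    obtain v where v: "v \<in> feasible I J" and desc: "\<forall>\<^sub>F t in at_right 0. loss A (y + t *\<^sub>R v) < loss A y"
      using descent_direction[OF dis yf ng[OF y]] .
    then obtain e where e: "e > 0" "\<And>t. 0 < t \<Longrightarrow> t < e \<Longrightarrow> loss A (y + t *\<^sub>R v) < loss A y"
      by (auto simp: eventually_at_right_field)
    \<comment> \<open>Half of \<open>e\<close> keeps the whole segment, endpoint included, in the
      range of descent.\<close>
    let ?w = "(e / 2) *\<^sub>R v"
    have "loss A (y + t *\<^sub>R ?w) \<le> \<alpha>" if "t \<in> {0..1}" for t
    proof (cases "t = 0")
      case False
      have "t * (e / 2) \<le> 1 * (e / 2)" using that e(1) by (intro mult_right_mono) auto
      then show ?thesis using e(2)[of "t * (e / 2)"] that False e(1) ly by auto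
    qed (use ly in auto)
    then have "closed_segment y (y + ?w) \<subseteq> ?E"
      unfolding closed_segment_add using yf v
      by (intro image_subsetI) (simp add: sublevel_def feasible_add feasible_scaleR)
    then have "y + ?w \<in> V" by (intro V_trans[OF y] path_component_linepath)
    moreover have "loss A (y + ?w) < loss A y" using e by simp
    ultimately show ?thesis by blast
  qed
  define r where "r = sqrt (CARD('r) + (norm A + sqrt \<alpha>)\<^sup>2)"
  have repr: "\<exists>z \<in> V \<inter> cball 0 r. loss A z = loss A y" if "y \<in> V" for y
  proof -
    have "y \<in> ?E" using that VE by blast
    then obtain z where "path_component ?E y z" "loss A z = loss A y" "norm z \<le> r"
      using sublevel_bounded_representative[OF dis] unfolding r_def by blast
    then show ?thesis using V_trans[OF that, of z] by (intro bexI[of _ z]) auto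
  qed
  have cpt: "compact (closure V \<inter> cball 0 r)" by (intro closed_Int_compact) auto
  have "closure V \<inter> cball 0 r \<noteq> {}"
    using repr[OF xV] closure_subset by blast
  from continuous_attains_inf[OF cpt this continuous_on_loss, of A]
  obtain y where y: "y \<in> closure V" "\<And>z. z \<in> closure V \<inter> cball 0 r \<Longrightarrow> loss A y \<le> loss A z"
    by auto
  have min: "loss A y \<le> loss A z" if "z \<in> V" for z
  proof -
    obtain z' where "z' \<in> V \<inter> cball 0 r" "loss A z' = loss A z" using repr[OF \<open>z \<in> V\<close>] by blast
    then show ?thesis using y(2)[of z'] closure_subset by auto
  qed
  have "closure V \<subseteq> feasible I J"
    using VE by (intro closure_minimal closed_subspace subspace_feasible) (auto simp: sublevel_def)
  then have yf: "y \<in> feasible I J" using y by auto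
  obtain x' where "x' \<in> V" "loss A x' < loss A x" using descend[OF xV] by blast
  \<comment> \<open>One descent step from \<open>x\<close> puts the infimum strictly below the
    level. Feasible points near \<open>y\<close> then stay in the sublevel set, and a segment joins
    \<open>y\<close> to a nearby point of \<open>V\<close>.\<close>
  then have "loss A y < \<alpha>" using min[of x'] x by (simp add: sublevel_def)
  then have "open {z. loss A z < \<alpha>}" "y \<in> {z. loss A z < \<alpha>}"
    by (auto intro: open_Collect_less continuous_on_loss)
  then obtain e where e: "e > 0" "ball y e \<subseteq> {z. loss A z < \<alpha>}"
    unfolding open_contains_ball by blast
  obtain z where z: "z \<in> V" "dist z y < e"
    using y(1) e(1) unfolding closure_approachable by blast
  have "closed_segment z y \<subseteq> ball y e \<inter> feasible I J"
    using z e(1) VE yf subspace_imp_convex[OF subspace_feasible, of I J]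
    by (intro closed_segment_subset convex_Int) (auto simp: dist_commute sublevel_def)
  then have "closed_segment z y \<subseteq> ?E" using e(2) by (auto simp: sublevel_def)
  then have "y \<in> V" by (intro V_trans[OF z(1)] path_component_linepath)
  then show False using descend min by fastforce
qed

theorem theorem4p12:
  fixes I :: "('m::finite \<times> 'r::finite) set"
    and J :: "('n::finite \<times> 'r) set"
    and A :: "real^'n^'m"
  assumes "disjoint_family_on (class_support I J) (support_classes I J)"
  shows "(\<nexists>V. spurious_local_valley (feasible I J) (loss A) V) \<and>
    (\<forall>x. critical_point (feasible I J) (loss A) x \<longrightarrow>
       global_minimizer (feasible I J) (loss A) x \<or>
       (\<exists>\<mu><0. hessian_eigenvalue (feasible I J) (loss A) x \<mu>)) \<and>
    (\<nexists>x. spurious_local_minimum (feasible I J) (loss A) x)"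
proof -
  have dis: "disjoint (range (rank_one_support I J))"
    using assms by (rule disjoint_rank_one_supports)
  have "global_minimizer (feasible I J) (loss A) x \<or>
       (\<exists>\<mu><0. hessian_eigenvalue (feasible I J) (loss A) x \<mu>)"
    if crit: "critical_point (feasible I J) (loss A) x" for x
    using second_order_imp_global_minimizer[OF dis _ critical_point_loss_imp[OF crit]]
      negative_hessian_eigenvalue[of _ I J x A] crit
    unfolding critical_point_def by (meson not_le)
  then show ?thesis
    using no_spurious_local_valley[OF dis] no_spurious_local_minimum[OF dis] by blast
qed

end
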